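(* Let $C>0$ and $\alpha>0$ be constants. Then $\Phi(G)=\Omega(m)$ for all $C$-Bipartite-Ramsey graphs $G=G(X,Y)$ with $|X||Y|=m$ and $|X|,|Y|\ge m^{\alpha}$. That is, there exist $c=c(C,\alpha)>0$ and $m_0=m_0(C,\alpha)$ such that for every integer $m\ge m_0$ and every $C$-Bipartite-Ramsey graph $G=G(X,Y)$ with $|X||Y|=m$, $|X|\ge m^{\alpha}$ and $|Y|\ge m^{\alpha}$, one has $\Phi(G)\ge c\,m$.
   Context: All graphs are finite and simple. $G=G(X,Y)$ denotes a bipartite graph with vertex classes $X$ and $Y$ (all edges go between $X$ and $Y$). $\log$ is the natural logarithm. For $C>0$, $G(X,Y)$ is called $C$-Bipartite-Ramsey if for all integers $a\ge C\log|X|$ and $b\ge C\log|Y|$ it does not contain $K_{a,b}$ or $\overline{K_{a,b}}$ as an induced subgraph; here this means that there are no $A\subseteq X$, $B\subseteq Y$ with $|A|=a$, $|B|=b$ such that all pairs in $A\times B$ are edges of $G$, or such that no pair in $A\times B$ is an edge of $G$. For a graph $H$, $e(H)$ is its number of edges. Define $\mathcal{M}(G)=\{e(H): H \text{ is an induced subgraph of } G\}$ and $\Phi(G)=|\mathcal{M}(G)|$. *)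

theory Defs
  imports Complex_Main
begin

text \<open>A graph is a pair of a vertex set and a set of edges, an edge being a two-element set
  of vertices.\<close>

type_synonym 'a graph = "'a set \<times> 'a set set"

abbreviation verts :: "'a graph \<Rightarrow> 'a set" where
  "verts G \<equiv> fst G"

abbreviation edges :: "'a graph \<Rightarrow> 'a set set" where
  "edges G \<equiv> snd G"

definition finite_simple_graph :: "'a graph \<Rightarrow> bool" where
  "finite_simple_graph G \<longleftrightarrow>
     finite (verts G) \<and> (\<forall>e \<in> edges G. e \<subseteq> verts G \<and> card e = 2)"

definition bipartite_graph :: "'a graph \<Rightarrow> 'a set \<Rightarrow> 'a set \<Rightarrow> bool" where
  "bipartite_graph G X Y \<longleftrightarrow>
     finite_simple_graph G \<and> verts G = X \<union> Y \<and> X \<inter> Y = {} \<and>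
     (\<forall>e \<in> edges G. \<exists>x \<in> X. \<exists>y \<in> Y. e = {x, y})"

definition bipartite_ramsey :: "real \<Rightarrow> 'a graph \<Rightarrow> 'a set \<Rightarrow> 'a set \<Rightarrow> bool" where
  "bipartite_ramsey C G X Y \<longleftrightarrow>
     bipartite_graph G X Y \<and>
     (\<forall>a b :: nat. real a \<ge> C * ln (real (card X)) \<longrightarrow> real b \<ge> C * ln (real (card Y)) \<longrightarrow>
        \<not> (\<exists>A B. A \<subseteq> X \<and> B \<subseteq> Y \<and> card A = a \<and> card B = b \<and>
             ((\<forall>x \<in> A. \<forall>y \<in> B. {x, y} \<in> edges G) \<or>
              (\<forall>x \<in> A. \<forall>y \<in> B. {x, y} \<notin> edges G))))"

definition induced_subgraph :: "'a graph \<Rightarrow> 'a graph \<Rightarrow> bool" where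
  "induced_subgraph H G \<longleftrightarrow>
     verts H \<subseteq> verts G \<and> edges H = {e \<in> edges G. e \<subseteq> verts H}"

definition edge_count :: "'a graph \<Rightarrow> nat" where
  "edge_count H = card (edges H)"

definition induced_sizes :: "'a graph \<Rightarrow> nat set" where
  "induced_sizes G = {edge_count H | H. induced_subgraph H G}"

definition Phi :: "'a graph \<Rightarrow> nat" where
  "Phi G = card (induced_sizes G)"

end

theory Submission
  imports Defs "HOL-Library.FuncSet" "HOL-Real_Asymp.Real_Asymp"
begin

text \<open>
  Write \<open>p = |X|\<close>, \<open>q = |Y|\<close> and let \<open>N(y)\<close> be the neighbourhood of \<open>y \<in> Y\<close>; by symmetry \<open>p \<le> q\<close>.
  The subgraph induced by \<open>A \<union> B\<close> with \<open>A \<subseteq> X\<close>, \<open>B \<subseteq> Y\<close> has \<open>\<Sum>y\<in>B. |N(y) \<inter> A|\<close> edges. The proof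
  fixes one set \<open>A\<close>, a typical random subset of \<open>X\<close>, and varies only \<open>B\<close>: it suffices that the numbers
  \<open>d(y) = |N(y) \<inter> A|\<close> have \<open>\<Omega>(pq)\<close> different subset sums. These are produced at three scales.

  \<^item> Coarse: at least \<open>q/4\<close> vertices have \<open>d(y) = \<Omega>(p)\<close>, and adding them one by one gives \<open>\<Omega>(q)\<close> sums
    with gaps \<open>\<Omega>(p)\<close>.
  \<^item> Middle: by pigeonhole some \<open>\<Omega>(\<surd>p)\<close> vertices of \<open>Y\<close> have degrees within \<open>\<surd>p\<close> of each other. Among them
    there are \<open>\<Omega>(\<surd>p)\<close> disjoint pairs \<open>y, y'\<close> with \<open>|d(y) - d(y')|\<close> of order \<open>\<surd>p\<close>, and exchanging \<open>y\<close> for \<open>y'\<close>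
    in one pair after the other gives \<open>\<Omega>(\<surd>p)\<close> sums with gaps of order \<open>\<surd>p\<close>.
  \<^item> Fine: \<open>\<Omega>(\<surd>p)\<close> pairs \<open>(z, z')\<close> from the same set of vertices have values \<open>d(z) + d(z')\<close> inside a window of
    length \<open>O(\<surd>p)\<close>, and \<open>\<Omega>(\<surd>p)\<close> of these values are different.

  With the constants right the total spread of each scale is below the gap of the next larger one, so all
  \<open>\<Omega>(q) \<cdot> \<Omega>(\<surd>p) \<cdot> \<Omega>(\<surd>p)\<close> combinations have different sums.

  For the middle and fine scales \<open>d\<close> has to be spread out: for a random \<open>A\<close>, a weighted sum
  \<open>\<Sum>x\<in>A. u(x)\<close> with bounded integers \<open>u(x)\<close> takes each value with probability \<open>O(1/\<surd>p)\<close> as soon as \<open>u\<close> is nonzero on \<open>\<Omega>(p)\<close> points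
  (\<open>card_subset_sums_le\<close>, a Littlewood-Offord bound). That so many coordinates are nonzero is where the
  Ramsey property enters. If about \<open>2 C log q\<close> vertices of \<open>Y\<close> were almost complete, or almost empty, to the
  same linear-sized \<open>U \<subseteq> X\<close>, a greedy choice among them would give a homogeneous pair of sets
  (\<open>exists_biclique_of_near_complete\<close>). Hence only \<open>D = O(log q)\<close> vertices behave like that; in particular a vertex
  has at most \<open>D\<close> near-twins, vertices whose neighbourhood differs from its own in at most a small constant
  proportion of \<open>X\<close>. The locale \<open>rich_bigraph\<close> captures this property.

  Near-twins are the reason for using pairs \<open>(z, z')\<close> at the fine scale. Vertices with almost equal degrees that
  are pairwise not near-twins may be scarcer than \<open>\<surd>p\<close> by a factor \<open>D\<close>, which would lose a logarithm. Sums of two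
  vertices win it back: \<open>D\<close> choices for \<open>z\<close> and \<open>O(\<surd>p / D)\<close> choices for \<open>z'\<close> suffice, and these can be made so
  that any two of the vectors \<open>1\<^bsub>N(z)\<^esub> + 1\<^bsub>N(z')\<^esub>\<close> differ in \<open>\<Omega>(p)\<close> coordinates
  (\<open>exists_sum_distinguished_pairs\<close>).
\<close>


section \<open>Sums over a random subset\<close>

text \<open>The factor \<open>2k + 1\<close>, rather than \<open>2k\<close>, makes the induction close: the step multiplies the left side by
  \<open>4 (2k + 1) (2k + 3) / (k + 1)\<^sup>2\<close>, and \<open>(2k + 1) (2k + 3) \<le> (2k + 2)\<^sup>2\<close>.\<close>

lemma central_binomial_sq_bound: "(2 * k + 1) * ((2 * k) choose k)\<^sup>2 \<le> 16 ^ k"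
proof (induction k)
  case 0
  then show ?case by simp
next
  case (Suc k)
  have rec: "Suc k * ((2 * Suc k) choose (Suc k)) = 2 * (2 * k + 1) * ((2 * k) choose k)"
  proof -
    have "Suc k * ((2 * Suc k) choose (Suc k)) = (2 * k + 2) * ((2 * k + 1) choose k)"
      using Suc_times_binomial_eq[of "2 * k + 1" k] by simp
    moreover have "Suc k * ((2 * k + 1) choose k) = (2 * k + 1) * ((2 * k) choose k)"
      using Suc_times_binomial_eq[of "2 * k" k] binomial_symmetric[of k "2 * k + 1"] by simp
    ultimately show ?thesis by (simp add: algebra_simps)
  qed
  let ?c = "((2 * k) choose k)" and ?d = "((2 * Suc k) choose (Suc k))"
  have "(Suc k)\<^sup>2 * ((2 * Suc k + 1) * ?d\<^sup>2) = (2 * k + 3) * (Suc k * ?d)\<^sup>2"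
    by (simp add: power2_eq_square algebra_simps)
  also have "\<dots> = 4 * (2 * k + 3) * (2 * k + 1) * ((2 * k + 1) * ?c\<^sup>2)"
    unfolding rec by (simp add: power2_eq_square algebra_simps)
  also have "\<dots> \<le> 4 * (2 * k + 3) * (2 * k + 1) * 16 ^ k"
    using Suc.IH by (intro mult_left_mono) auto
  also have "\<dots> \<le> 16 * (Suc k)\<^sup>2 * 16 ^ k"
    by (intro mult_right_mono) (auto simp: power2_eq_square algebra_simps)
  finally have "(Suc k)\<^sup>2 * ((2 * Suc k + 1) * ?d\<^sup>2) \<le> (Suc k)\<^sup>2 * 16 ^ Suc k"
    by (simp add: mult_ac)
  then show ?case by (subst (asm) mult_le_cancel1) simp
qed

lemma binomial_le_over_sqrt:
  assumes "n > 0"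
  shows "real (n choose j) \<le> 2 ^ n / sqrt (real n)"
proof -
  have mid: "real ((2 * k) choose k) \<le> 2 ^ (2 * k) / sqrt (real (2 * k))" if "k > 0" for k
  proof -
    have "real (2 * k) * (real ((2 * k) choose k))\<^sup>2 \<le> real ((2 * k + 1) * ((2 * k) choose k)\<^sup>2)"
      by simp
    also have "\<dots> \<le> real (16 ^ k)"
      using central_binomial_sq_bound of_nat_le_iff by blast
    also have "\<dots> = ((2::real) ^ (2 * k))\<^sup>2"
      by (simp add: power_mult power2_eq_square flip: power_mult_distrib)
    finally have "sqrt (real (2 * k) * (real ((2 * k) choose k))\<^sup>2) \<le> 2 ^ (2 * k)"
      by (intro real_le_lsqrt) auto
    with that show ?thesis by (simp add: real_sqrt_mult field_simps)
  qed
  have max: "n choose j \<le> n choose (n div 2)"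
    by (rule binomial_maximum)
  show ?thesis
  proof (cases "even n")
    case True
    then obtain k where "n = 2 * k" by blast
    have "n choose (n div 2) = (2 * k) choose k" using \<open>n = 2 * k\<close> by simp
    then show ?thesis using mid[of k] assms max \<open>n = 2 * k\<close>
      by (metis mult_0_right neq0_conv of_nat_le_iff order_trans)
  next
    case False
    then obtain k where n: "n = 2 * k + 1" by (auto elim: oddE)
    have "(2 * Suc k) choose (Suc k) = 2 * (n choose k)"
      using binomial_symmetric[of k n] by (simp add: n)
    then have "2 * real (n choose k) \<le> 2 ^ (2 * Suc k) / sqrt (real (2 * Suc k))"
      using mid[of "Suc k"] by simp
    also have "\<dots> \<le> 2 ^ (2 * Suc k) / sqrt (real n)"
      using n by (intro divide_left_mono) auto
    finally have "real (n choose k) \<le> 2 ^ n / sqrt (real n)"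
      by (simp add: n)
    moreover have "n div 2 = k" using n by simp
    ultimately show ?thesis using max by (metis of_nat_le_iff order_trans)
  qed
qed

text \<open>Complementing \<open>A\<close> on the points where \<open>u = - a\<close> turns \<open>sum u A\<close> into a count: the value \<open>k\<close> determines the
  size of the changed set. So the sets counted here are in bijection with sets of one fixed size.\<close>

lemma card_signed_subset_sums_le:
  fixes u :: "'x \<Rightarrow> int"
  assumes "finite S" and "S \<noteq> {}" and "a > 0" and "\<And>x. x \<in> S \<Longrightarrow> \<bar>u x\<bar> = a"
  shows "real (card {A \<in> Pow S. sum u A = k}) \<le> 2 ^ card S / sqrt (real (card S))"
proof (cases "{A \<in> Pow S. sum u A = k} = {}")
  case True
  then show ?thesis by (simp only: True) simp
next
  case False
  then obtain A0 where A0: "A0 \<subseteq> S" "sum u A0 = k" by blast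
  define Q where "Q = {x \<in> S. u x = - a}"
  define flip where "flip A = (A - Q) \<union> (Q - A)" for A
  have Q: "Q \<subseteq> S" "finite Q" using assms by (auto simp: Q_def)
  have card_flip: "a * int (card (flip A)) = a * int (card Q) + sum u A" if "A \<subseteq> S" for A
  proof -
    have fin: "finite A" using that assms finite_subset by blast
    have "sum u A = sum u (A - Q) + sum u (A \<inter> Q)"
      using fin by (metis Int_Diff_Un add.commute sum.Int_Diff)
    moreover have "sum u (A - Q) = (\<Sum>x\<in>A - Q. a)"
      proof (rule sum.cong)
      fix x assume x: "x \<in> A - Q"
      then have "x \<in> S" using that by blast
      from assms(4)[OF this] x this show "u x = a" by (auto simp: Q_def abs_if split: if_splits)
    qed simp
    moreover have "sum u (A \<inter> Q) = (\<Sum>x\<in>A \<inter> Q. - a)"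
      by (intro sum.cong) (auto simp: Q_def)
    moreover have "card (flip A) = card (A - Q) + card (Q - A)"
      unfolding flip_def using fin Q by (intro card_Un_disjoint) auto
    moreover have "card Q = card (Q - A) + card (A \<inter> Q)"
      using Q by (metis Int_commute add.commute card_Diff_subset_Int card_mono finite_Int inf_le1
          le_add_diff_inverse)
    ultimately show ?thesis by (simp add: algebra_simps)
  qed
  define j where "j = card (flip A0)"
  have inj: "inj_on flip UNIV"
    by (intro inj_onI) (auto simp: flip_def set_eq_iff)
  have "flip ` {A \<in> Pow S. sum u A = k} \<subseteq> {B. B \<subseteq> S \<and> card B = j}"
  proof clarify
    fix A assume A: "A \<subseteq> S" "k = sum u A"
    have "a * int (card (flip A)) = a * int j"
      using card_flip[OF A(1)] card_flip[OF A0(1)] A A0 by (simp add: j_def)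
    then have "card (flip A) = j" using \<open>a > 0\<close> by simp
    then show "flip A \<subseteq> S \<and> card (flip A) = j" using A Q by (auto simp: flip_def)
  qed
  then have "card (flip ` {A \<in> Pow S. sum u A = k}) \<le> card {B. B \<subseteq> S \<and> card B = j}"
    using assms(1) by (intro card_mono) auto
  moreover have "card (flip ` {A \<in> Pow S. sum u A = k}) = card {A \<in> Pow S. sum u A = k}"
    using inj by (intro card_image) (rule inj_on_subset, auto)
  ultimately have "card {A \<in> Pow S. sum u A = k} \<le> card S choose j"
    using n_subsets[OF assms(1)] by simp
  also have "real (card S choose j) \<le> 2 ^ card S / sqrt (real (card S))"
    using assms by (intro binomial_le_over_sqrt) (simp add: card_gt_0_iff)
  finally show ?thesis by simp
qed

text \<open>A Littlewood-Offord bound. The points outside \<open>S\<close> only shift the value that the sum over \<open>S\<close> has to take, so the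
  bound for \<open>S\<close> alone, which is uniform in that value, survives the addition of further points.\<close>

lemma card_subset_sums_le:
  fixes u :: "'x \<Rightarrow> int"
  assumes "finite X" and "S \<subseteq> X" and "S \<noteq> {}" and "a > 0" and "\<And>x. x \<in> S \<Longrightarrow> \<bar>u x\<bar> = a"
  shows "real (card {A \<in> Pow X. sum u A = k}) \<le> 2 ^ card X / sqrt (real (card S))"
proof -
  have finS: "finite S" using assms finite_subset by blast
  have "real (card {A \<in> Pow (S \<union> R). sum u A = k}) \<le> 2 ^ card (S \<union> R) / sqrt (real (card S))"
    if "finite R" "R \<inter> S = {}" for R k
    using that
  proof (induction R arbitrary: k rule: finite_induct)
    case empty
    then show ?case using card_signed_subset_sums_le[OF finS assms(3-5)] by simp
  next
    case (insert x R)
    let ?Y = "S \<union> R"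
    have x: "x \<notin> ?Y" "finite ?Y" using insert finS by auto
    have "{A \<in> Pow (S \<union> insert x R). sum u A = k}
        \<subseteq> {A \<in> Pow ?Y. sum u A = k} \<union> insert x ` {A \<in> Pow ?Y. sum u A = k - u x}"
    proof
      fix A assume A: "A \<in> {A \<in> Pow (S \<union> insert x R). sum u A = k}"
      show "A \<in> {A \<in> Pow ?Y. sum u A = k} \<union> insert x ` {A \<in> Pow ?Y. sum u A = k - u x}"
      proof (cases "x \<in> A")
        case True
        have "finite A" using A x by (auto intro: finite_subset)
        then have "sum u (A - {x}) = k - u x" using A True by (simp add: sum_diff1)
        then have "A - {x} \<in> {A \<in> Pow ?Y. sum u A = k - u x}" using A by auto
        then show ?thesis using True by (metis (no_types, lifting) UnI2 image_eqI insert_Diff)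
      qed (use A in auto)
    qed
    then have "card {A \<in> Pow (S \<union> insert x R). sum u A = k}
        \<le> card ({A \<in> Pow ?Y. sum u A = k} \<union> insert x ` {A \<in> Pow ?Y. sum u A = k - u x})"
      using x by (intro card_mono) auto
    also have "\<dots> \<le> card {A \<in> Pow ?Y. sum u A = k} + card (insert x ` {A \<in> Pow ?Y. sum u A = k - u x})"
      by (rule card_Un_le)
    also have "\<dots> \<le> card {A \<in> Pow ?Y. sum u A = k} + card {A \<in> Pow ?Y. sum u A = k - u x}"
      using x by (intro add_left_mono card_image_le) auto
    finally have "real (card {A \<in> Pow (S \<union> insert x R). sum u A = k}) \<le>
        real (card {A \<in> Pow ?Y. sum u A = k}) + real (card {A \<in> Pow ?Y. sum u A = k - u x})"
      by linarith
    also have "\<dots> \<le> 2 ^ card ?Y / sqrt (real (card S)) + 2 ^ card ?Y / sqrt (real (card S))"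
      using insert.prems by (intro add_mono insert.IH) auto
    also have "\<dots> = 2 ^ card (S \<union> insert x R) / sqrt (real (card S))"
      using x by simp
    finally show ?case .
  qed
  from this[of "X - S"] show ?thesis using assms(1,2) by (simp add: Un_absorb1 Int_commute)
qed

lemma sum_Pow_insert:
  fixes f :: "'x set \<Rightarrow> 'b::comm_monoid_add"
  assumes "finite X" and "x \<notin> X"
  shows "sum f (Pow (insert x X)) = (\<Sum>A\<in>Pow X. f A + f (insert x A))"
proof -
  have "inj_on (insert x) (Pow X)"
    using assms(2) by (intro inj_onI) (metis Diff_insert_absorb PowD subsetD)
  moreover have "Pow X \<inter> insert x ` Pow X = {}" using assms(2) by auto
  ultimately show ?thesis
    using assms(1) by (simp add: Pow_insert sum.union_disjoint sum.reindex sum.distrib o_def)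
qed

text \<open>For random \<open>A\<close> the number \<open>2 |S \<inter> A| - |S|\<close> is a sum of \<open>|S|\<close> independent signs, so its variance is \<open>|S|\<close>.\<close>

lemma sum_Pow_square_deviation:
  assumes "finite X" and "S \<subseteq> X"
  shows "(\<Sum>A\<in>Pow X. (2 * real (card (S \<inter> A)) - real (card S))\<^sup>2) = 2 ^ card X * real (card S)"
  using assms
proof (induction X arbitrary: S rule: finite_induct)
  case empty
  then show ?case by simp
next
  case (insert x X)
  show ?case
  proof (cases "x \<in> S")
    case False
    then have "S \<subseteq> X" using insert by auto
    moreover have "S \<inter> insert x A = S \<inter> A" for A using False by auto
    ultimately show ?thesis
      using insert by (simp add: sum_Pow_insert flip: sum_distrib_left)
  next
    case True
    define T where "T = S - {x}"
    have T: "T \<subseteq> X" "finite T" "S = insert x T" "x \<notin> T"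
      using True insert by (auto simp: T_def intro: finite_subset)
    have "(2 * real (card (S \<inter> A)) - real (card S))\<^sup>2 + (2 * real (card (S \<inter> insert x A)) - real (card S))\<^sup>2
        = 2 * (2 * real (card (T \<inter> A)) - real (card T))\<^sup>2 + 2" if "A \<in> Pow X" for A
    proof -
      have "S \<inter> A = T \<inter> A" using that insert T by auto
      moreover have "S \<inter> insert x A = insert x (T \<inter> A)" using T by auto
      moreover have "card (insert x (T \<inter> A)) = Suc (card (T \<inter> A))" using T by simp
      moreover have "card S = Suc (card T)" using T by simp
      ultimately show ?thesis by (simp add: power2_eq_square algebra_simps)
    qed
    then have "(\<Sum>A\<in>Pow (insert x X). (2 * real (card (S \<inter> A)) - real (card S))\<^sup>2)
        = (\<Sum>A\<in>Pow X. 2 * (2 * real (card (T \<inter> A)) - real (card T))\<^sup>2 + 2)"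
      using insert by (simp add: sum_Pow_insert)
    also have "\<dots> = 2 * (2 ^ card X * real (card T)) + 2 * 2 ^ card X"
      using insert.IH[OF T(1)] insert.hyps
      by (simp add: sum.distrib card_Pow flip: sum_distrib_left)
    also have "\<dots> = 2 ^ card (insert x X) * real (card S)"
      using insert.hyps T by (simp add: algebra_simps)
    finally show ?thesis .
  qed
qed

text \<open>Chebyshev's inequality.\<close>

lemma card_large_deviation_le:
  assumes "finite X" and "S \<subseteq> X" and "t > 0"
  shows "real (card {A \<in> Pow X. \<bar>2 * real (card (S \<inter> A)) - real (card S)\<bar> > t})
    \<le> 2 ^ card X * real (card X) / t\<^sup>2"
proof -
  let ?B = "{A \<in> Pow X. \<bar>2 * real (card (S \<inter> A)) - real (card S)\<bar> > t}"
  have "real (card ?B) * t\<^sup>2 = (\<Sum>A\<in>?B. t\<^sup>2)" by simp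
  also have "\<dots> \<le> (\<Sum>A\<in>?B. (2 * real (card (S \<inter> A)) - real (card S))\<^sup>2)"
    using assms(3) by (intro sum_mono) (auto simp: abs_le_square_iff[symmetric])
  also have "\<dots> \<le> (\<Sum>A\<in>Pow X. (2 * real (card (S \<inter> A)) - real (card S))\<^sup>2)"
    using assms(1) by (intro sum_mono2) auto
  also have "\<dots> \<le> 2 ^ card X * real (card X)"
    using assms by (simp add: sum_Pow_square_deviation card_mono)
  finally show ?thesis using assms(3) by (simp add: field_simps)
qed

section \<open>Selection and averaging\<close>

lemma sum_card_swap:
  assumes "finite A" and "finite B"
  shows "(\<Sum>a\<in>A. real (card {b \<in> B. P a b})) = (\<Sum>b\<in>B. real (card {a \<in> A. P a b}))"
proof -
  have "(\<Sum>a\<in>A. card {b \<in> B. P a b}) = (\<Sum>b\<in>B. card {a \<in> A. P a b})"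
    unfolding card_eq_sum using assms by (rule sum.swap_restrict)
  then show ?thesis by (simp flip: of_nat_sum)
qed

text \<open>Greedy: take any point, discard the at most \<open>D\<close> points related to it, and repeat.\<close>

lemma exists_independent_subset:
  assumes "finite S" and "\<And>x. x \<in> S \<Longrightarrow> R x x" and "\<And>x y. R x y \<Longrightarrow> R y x"
    and "\<And>x. x \<in> S \<Longrightarrow> card {y \<in> S. R x y} \<le> D"
  shows "\<exists>T\<subseteq>S. card S \<le> D * card T \<and> (\<forall>x\<in>T. \<forall>y\<in>T. x \<noteq> y \<longrightarrow> \<not> R x y)"
  using assms(1,2,4)
proof (induction S rule: finite_psubset_induct)
  case (psubset S)
  show ?case
  proof (cases "S = {}")
    case False
    then obtain x where x: "x \<in> S" by blast
    define S' where "S' = {y \<in> S. \<not> R x y}"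
    have "S' \<subset> S" using x psubset.prems(1) by (auto simp: S'_def)
    moreover have "card {z \<in> S'. R y z} \<le> D" if "y \<in> S'" for y
    proof -
      have "card {z \<in> S'. R y z} \<le> card {z \<in> S. R y z}"
        using psubset.hyps by (intro card_mono) (auto simp: S'_def)
      with psubset.prems(2)[of y] that show ?thesis by (simp add: S'_def)
    qed
    ultimately obtain T where T: "T \<subseteq> S'" "card S' \<le> D * card T"
        "\<forall>x\<in>T. \<forall>y\<in>T. x \<noteq> y \<longrightarrow> \<not> R x y"
      using psubset.IH[of S'] psubset.prems(1) by (auto simp: S'_def)
    have "finite T" "x \<notin> T"
      using T(1) psubset.hyps x psubset.prems(1) by (auto simp: S'_def intro: finite_subset)
    have "S = S' \<union> {y \<in> S. R x y}" by (auto simp: S'_def)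
    then have "card S \<le> card S' + card {y \<in> S. R x y}" by (metis card_Un_le)
    also have "\<dots> \<le> D * card (insert x T)"
      using T(2) psubset.prems(2)[OF x] \<open>finite T\<close> \<open>x \<notin> T\<close> by simp
    finally have "card S \<le> D * card (insert x T)" .
    moreover have "\<forall>y\<in>insert x T. \<forall>z\<in>insert x T. y \<noteq> z \<longrightarrow> \<not> R y z"
      using T(1,3) assms(3) by (auto simp: S'_def)
    moreover have "insert x T \<subseteq> S" using T(1) x by (auto simp: S'_def)
    ultimately show ?thesis by blast
  qed auto
qed

text \<open>Greedy: as long as more than \<open>D\<close> points are unused, an unused point has an unused partner that is not
  related to it.\<close>

lemma exists_disjoint_unrelated_pairs:
  assumes "finite S" and "\<And>x. x \<in> S \<Longrightarrow> R x x"
    and "\<And>x. x \<in> S \<Longrightarrow> card {y \<in> S. R x y} \<le> D" and "2 * t + D \<le> card S"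
  shows "\<exists>a b :: nat \<Rightarrow> 'a. (\<forall>i<t. a i \<in> S \<and> b i \<in> S \<and> \<not> R (a i) (b i)) \<and>
           (\<forall>i<t. \<forall>j<t. i \<noteq> j \<longrightarrow> {a i, b i} \<inter> {a j, b j} = {})"
  using assms(4)
proof (induction t)
  case (Suc t)
  then obtain a b :: "nat \<Rightarrow> 'a" where ab: "\<forall>i<t. a i \<in> S \<and> b i \<in> S \<and> \<not> R (a i) (b i)"
      "\<forall>i<t. \<forall>j<t. i \<noteq> j \<longrightarrow> {a i, b i} \<inter> {a j, b j} = {}"
    by auto
  define U where "U = a ` {..<t} \<union> b ` {..<t}"
  have "card U \<le> card (a ` {..<t}) + card (b ` {..<t})" unfolding U_def by (rule card_Un_le)
  also have "\<dots> \<le> 2 * t"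
    using card_image_le[of "{..<t}" a] card_image_le[of "{..<t}" b] by simp
  finally have U: "card U \<le> 2 * t" "finite U" "U \<subseteq> S" using ab(1) by (auto simp: U_def)
  have cU: "card (S - U) \<ge> 2 + D" using U Suc.prems by (simp add: card_Diff_subset)
  then obtain x where x: "x \<in> S - U"
    by (metis add_is_0 card.empty ex_in_conv le_zero_eq zero_neq_numeral)
  have "\<exists>y\<in>S - U. \<not> R x y"
  proof (rule ccontr)
    assume "\<not> ?thesis"
    then have "card (S - U) \<le> card {y \<in> S. R x y}" using assms(1) by (intro card_mono) auto
    with cU assms(3)[of x] x show False by simp
  qed
  then obtain y where y: "y \<in> S - U" "\<not> R x y" by blast
  have "x \<noteq> a i" "x \<noteq> b i" "y \<noteq> a i" "y \<noteq> b i" if "i < t" for i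
    using x y that by (auto simp: U_def)
  then have "(\<forall>i<Suc t. (a(t := x)) i \<in> S \<and> (b(t := y)) i \<in> S \<and> \<not> R ((a(t := x)) i) ((b(t := y)) i)) \<and>
      (\<forall>i<Suc t. \<forall>j<Suc t. i \<noteq> j \<longrightarrow>
        {(a(t := x)) i, (b(t := y)) i} \<inter> {(a(t := x)) j, (b(t := y)) j} = {})"
    using ab x y by (auto simp: less_Suc_eq)
  then show ?case by blast
qed simp

text \<open>The interval \<open>[0, p]\<close> is covered by about \<open>\<surd>p\<close> intervals of length \<open>\<surd>p\<close>, and one of them receives at least
  the average number of values.\<close>

lemma exists_large_bucket:
  fixes d :: "'y \<Rightarrow> nat"
  assumes "finite Y" and "0 < p" and "p \<le> card Y" and "\<And>y. y \<in> Y \<Longrightarrow> d y \<le> p"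
  shows "\<exists>Z\<subseteq>Y. sqrt (real p) / 2 \<le> real (card Z) \<and>
           (\<forall>y\<in>Z. \<forall>y'\<in>Z. \<bar>real (d y) - real (d y')\<bar> \<le> sqrt (real p))"
proof -
  define r where "r = sqrt (real p)"
  have r: "r \<ge> 1" "r * r = real p" using assms(2) by (auto simp: r_def)
  define f where "f y = nat \<lfloor>real (d y) / r\<rfloor>" for y
  let ?B = "{..nat \<lfloor>r\<rfloor>}"
  have "f \<in> Y \<rightarrow> ?B"
  proof
    fix y assume "y \<in> Y"
    then have "real (d y) \<le> r * r" using assms(4) r by simp
    then have "real (d y) / r \<le> r" using r by (simp add: field_simps)
    then show "f y \<in> ?B" by (auto simp: f_def intro!: nat_mono floor_mono)
  qed
  then obtain b where b: "card Y \<le> card (f -` {b} \<inter> Y) * card ?B"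
    using pigeonhole_card[of f Y ?B] assms(1) by auto
  define Z where "Z = f -` {b} \<inter> Y"
  have "real (card ?B) = real_of_int \<lfloor>r\<rfloor> + 1" using r by simp
  then have "real (card ?B) \<le> 2 * r" using r of_int_floor_le[of r] by linarith
  then have "real (card Z) * real (card ?B) \<le> real (card Z) * (2 * r)"
    by (intro mult_left_mono) auto
  moreover have "r * r \<le> real (card Z) * real (card ?B)"
    using b assms(3) r(2) unfolding Z_def by (metis of_nat_le_iff of_nat_mult order_trans)
  ultimately have "r * r \<le> (2 * real (card Z)) * r" by simp
  then have "r \<le> 2 * real (card Z)" by (rule mult_right_le_imp_le) (use r in linarith)
  then have "r / 2 \<le> real (card Z)" by simp
  moreover have "\<bar>real (d y) - real (d y')\<bar> \<le> r" if "y \<in> Z" "y' \<in> Z" for y y'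
  proof -
    have "\<lfloor>real (d y) / r\<rfloor> = \<lfloor>real (d y') / r\<rfloor>"
    proof -
      have "nat \<lfloor>real (d y) / r\<rfloor> = nat \<lfloor>real (d y') / r\<rfloor>" using that by (auto simp: Z_def f_def)
      moreover have "\<lfloor>real (d y) / r\<rfloor> \<ge> 0" "\<lfloor>real (d y') / r\<rfloor> \<ge> 0" using r by auto
      ultimately show ?thesis by linarith
    qed
    then have "\<bar>real (d y) / r - real (d y') / r\<bar> \<le> 1" by linarith
    then have "\<bar>real (d y) - real (d y')\<bar> / r \<le> 1"
      using r by (simp flip: diff_divide_distrib add: abs_divide)
    then show ?thesis using r by (simp add: field_simps)
  qed
  ultimately show ?thesis unfolding r_def[symmetric] by (intro exI[of _ Z]) (auto simp: Z_def)
qed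

text \<open>In each fibre of \<open>g\<close> every point other than a chosen one collides with the chosen one.\<close>

lemma card_le_card_image_plus_collisions:
  assumes "finite P"
  shows "card P \<le> card (g ` P) + card {(x, y) \<in> P \<times> P. x \<noteq> y \<and> g x = g y}"
  using assms
proof (induction P rule: finite_induct)
  case (insert a P)
  let ?C = "\<lambda>P. {(x, y) \<in> P \<times> P. x \<noteq> y \<and> g x = g y}"
  have fin: "finite (?C (insert a P))"
  proof (rule finite_subset)
    show "?C (insert a P) \<subseteq> insert a P \<times> insert a P" by blast
    show "finite (insert a P \<times> insert a P)" using insert.hyps by blast
  qed
  show ?case
  proof (cases "g a \<in> g ` P")
    case True
    then obtain b where b: "b \<in> P" "g a = g b" by blast
    have "insert (a, b) (?C P) \<subseteq> ?C (insert a P)" using b insert.hyps by auto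
    then have "card (insert (a, b) (?C P)) \<le> card (?C (insert a P))" using fin by (rule card_mono[rotated])
    moreover have "(a, b) \<notin> ?C P" using insert.hyps by auto
    moreover have "finite (?C P)" using fin by (rule rev_finite_subset) auto
    ultimately have "Suc (card (?C P)) \<le> card (?C (insert a P))" by simp
    with insert show ?thesis by (simp add: True insert_absorb)
  next
    case False
    have "card (?C P) \<le> card (?C (insert a P))" using fin by (rule card_mono) auto
    with insert False show ?thesis by simp
  qed
qed simp

text \<open>The mean of \<open>f1 / n1 + f2 / n2 + f3 / n3\<close> is at most \<open>3 / 6\<close>, so at some point all three summands are at
  most \<open>1 / 2\<close>.\<close>

lemma exists_simultaneously_small:
  fixes f1 f2 f3 :: "'a \<Rightarrow> real" and n1 n2 n3 :: real
  assumes "finite \<Omega>" and "\<Omega> \<noteq> {}" and "n1 > 0" and "n2 > 0" and "n3 > 0"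
    and "\<And>A. A \<in> \<Omega> \<Longrightarrow> f1 A \<ge> 0 \<and> f2 A \<ge> 0 \<and> f3 A \<ge> 0"
    and "sum f1 \<Omega> \<le> card \<Omega> * n1 / 6" and "sum f2 \<Omega> \<le> card \<Omega> * n2 / 6"
    and "sum f3 \<Omega> \<le> card \<Omega> * n3 / 6"
  shows "\<exists>A\<in>\<Omega>. f1 A \<le> n1 / 2 \<and> f2 A \<le> n2 / 2 \<and> f3 A \<le> n3 / 2"
proof (rule ccontr)
  assume neg: "\<not> ?thesis"
  have "1 / 2 < f1 A / n1 + f2 A / n2 + f3 A / n3" if "A \<in> \<Omega>" for A
  proof -
    have "f1 A / n1 > 1 / 2 \<or> f2 A / n2 > 1 / 2 \<or> f3 A / n3 > 1 / 2"
      using neg that assms(3-5) by (fastforce simp: field_simps)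
    moreover have "f1 A / n1 \<ge> 0" "f2 A / n2 \<ge> 0" "f3 A / n3 \<ge> 0"
      using assms(3-6) that by auto
    ultimately show ?thesis by linarith
  qed
  then have "(\<Sum>A\<in>\<Omega>. 1 / 2) < (\<Sum>A\<in>\<Omega>. f1 A / n1 + f2 A / n2 + f3 A / n3)"
    using assms(1,2) by (intro sum_strict_mono) auto
  also have "\<dots> = sum f1 \<Omega> / n1 + sum f2 \<Omega> / n2 + sum f3 \<Omega> / n3"
    by (simp add: sum.distrib sum_divide_distrib)
  also have "\<dots> \<le> card \<Omega> / 6 + card \<Omega> / 6 + card \<Omega> / 6"
    using assms(3-5,7-9) by (intro add_mono) (auto simp: field_simps)
  finally show False by simp
qed

section \<open>Separated sets of sums\<close>

definition separated :: "real \<Rightarrow> real set \<Rightarrow> bool" where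
  "separated G V \<longleftrightarrow> (\<forall>x\<in>V. \<forall>y\<in>V. x < y \<longrightarrow> x + G \<le> y)"

text \<open>This is how two scales are combined: no two sums coincide when the spread of \<open>W\<close> is below the gap of \<open>V\<close>.\<close>

lemma card_sumset_separated:
  assumes "separated G V" and "\<And>x y. x \<in> W \<Longrightarrow> y \<in> W \<Longrightarrow> x - y < G"
  shows "card ((\<lambda>(v, w). v + w) ` (V \<times> W)) = card V * card W"
proof -
  have "inj_on (\<lambda>(v, w). v + w) (V \<times> W)"
  proof (rule inj_onI, clarify)
    fix v w v' w' assume *: "v \<in> V" "w \<in> W" "v' \<in> V" "w' \<in> W" "v + w = v' + w'"
    have "v = v'"
    proof (rule ccontr)
      assume "v \<noteq> v'"
      then consider "v + G \<le> v'" | "v' + G \<le> v"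
        using assms(1) * by (fastforce simp: separated_def neq_iff)
      then show False using assms(2)[of w w'] assms(2)[of w' w] * by cases auto
    qed
    with * show "v = v' \<and> w = w'" by simp
  qed
  then show ?thesis by (simp add: card_image card_cartesian_product)
qed

text \<open>Add the elements of \<open>B\<close> in blocks of \<open>M\<close>; each block raises the sum by at least \<open>M \<tau>\<close>. Large \<open>M\<close> buys a
  larger gap at the price of a factor \<open>M\<close> in the number of sums. The bounds on the sums serve the induction,
  where the full sum is appended as a new maximum.\<close>

lemma exists_separated_subset_sums:
  fixes w :: "'y \<Rightarrow> real"
  assumes "finite B" and "\<And>y. y \<in> B \<Longrightarrow> \<tau> \<le> w y" and "\<tau> > 0" and "M > 0"
  shows "\<exists>V \<subseteq> sum w ` Pow B. separated (real M * \<tau>) V \<and> card V = Suc (card B div M) \<and>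
           (\<forall>v\<in>V. 0 \<le> v \<and> v \<le> sum w B)"
  using assms(1,2)
proof (induction B rule: finite_psubset_induct)
  case (psubset B)
  have nonneg: "w y \<ge> 0" if "y \<in> B" for y using psubset.prems[OF that] assms(3) by linarith
  show ?case
  proof (cases "card B < M")
    case True
    have "0 \<in> sum w ` Pow B" by (metis Pow_bottom image_eqI sum.empty)
    with True nonneg show ?thesis
      by (intro exI[of _ "{0}"]) (auto simp: separated_def intro!: sum_nonneg)
  next
    case False
    then obtain K where K: "K \<subseteq> B" "card K = M" "finite K"
      by (metis linorder_not_less obtain_subset_with_card_n)
    have "B - K \<subset> B" using K assms(4) by (metis Diff_cancel Diff_eq_empty_iff Diff_subset
          card.empty double_diff less_numeral_extra(3) order_refl psubsetI)
    then obtain V where V: "V \<subseteq> sum w ` Pow (B - K)" "separated (real M * \<tau>) V"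
        "card V = Suc (card (B - K) div M)" "\<forall>v\<in>V. 0 \<le> v \<and> v \<le> sum w (B - K)"
      using psubset.IH[of "B - K"] psubset.prems by auto
    have sumB: "sum w B = sum w (B - K) + sum w K"
      using K psubset.hyps by (simp add: sum.subset_diff)
    have "(\<Sum>y\<in>K. \<tau>) \<le> sum w K" using K psubset.prems by (intro sum_mono) auto
    then have top: "sum w (B - K) + real M * \<tau> \<le> sum w B" using K sumB by simp
    have gap: "v + real M * \<tau> \<le> sum w B" if "v \<in> V" for v using V(4) that top by fastforce
    have pos: "real M * \<tau> > 0" using assms(3,4) by simp
    have new: "sum w B \<notin> V" using gap pos by fastforce
    have "card B = card (B - K) + M" using K psubset.hyps
      by (metis card_Diff_subset card_mono le_add_diff_inverse2)
    then have "card (insert (sum w B) V) = Suc (card B div M)"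
      using V(3) new assms(4) card_ge_0_finite[of V] by simp
    moreover have "separated (real M * \<tau>) (insert (sum w B) V)"
      using V(2) gap pos by (fastforce simp: separated_def)
    moreover have "insert (sum w B) V \<subseteq> sum w ` Pow B"
      using V(1) image_mono[of "Pow (B - K)" "Pow B" "sum w"] by (simp add: Pow_mono)
    moreover have "\<forall>v\<in>insert (sum w B) V. 0 \<le> v \<and> v \<le> sum w B"
      using V(4) gap pos nonneg by (fastforce intro: sum_nonneg)
    ultimately show ?thesis by blast
  qed
qed

text \<open>From each pair \<open>{a i, b i}\<close> choose one element. Choosing the heavier instead of the lighter one raises the
  sum by \<open>|w (a i) - w (b i)|\<close>, so up to a constant the sums are the subset sums of these differences.\<close>

lemma exists_separated_swap_sums:
  fixes w :: "'y \<Rightarrow> real" and a b :: "'i \<Rightarrow> 'y"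
  assumes "finite I" and "\<tau> > 0" and "M > 0"
    and disj: "\<And>i j. i \<in> I \<Longrightarrow> j \<in> I \<Longrightarrow> i \<noteq> j \<Longrightarrow> {a i, b i} \<inter> {a j, b j} = {}"
    and diff: "\<And>i. i \<in> I \<Longrightarrow> \<tau> \<le> \<bar>w (a i) - w (b i)\<bar> \<and> \<bar>w (a i) - w (b i)\<bar> \<le> \<rho>"
  shows "\<exists>V \<subseteq> sum w ` Pow (a ` I \<union> b ` I). separated (real M * \<tau>) V \<and>
           card V = Suc (card I div M) \<and> (\<forall>x\<in>V. \<forall>y\<in>V. x - y \<le> \<rho> * real (card I))"
proof -
  define D where "D i = \<bar>w (a i) - w (b i)\<bar>" for i
  define m where "m = (\<Sum>i\<in>I. min (w (a i)) (w (b i)))"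
  obtain V where V: "V \<subseteq> sum D ` Pow I" "separated (real M * \<tau>) V"
      "card V = Suc (card I div M)" "\<forall>v\<in>V. 0 \<le> v \<and> v \<le> sum D I"
    using exists_separated_subset_sums[of I \<tau> D M] assms(1-3) diff unfolding D_def by blast
  define V' where "V' = (+) m ` V"
  have "V' \<subseteq> sum w ` Pow (a ` I \<union> b ` I)"
  proof
    fix v assume "v \<in> V'"
    then obtain J where J: "J \<subseteq> I" "v = m + sum D J" using V(1) by (auto simp: V'_def)
    \<comment> \<open>The set that realises a given sum takes the heavier element exactly for the indices in \<open>J\<close>.\<close>
    define hi where "hi i = (if w (a i) \<ge> w (b i) then a i else b i)" for i
    define lo where "lo i = (if w (a i) \<ge> w (b i) then b i else a i)" for i
    define \<sigma> where "\<sigma> i = (if i \<in> J then hi i else lo i)" for i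
    have \<sigma>: "\<sigma> i \<in> {a i, b i}" for i by (simp add: \<sigma>_def hi_def lo_def)
    have "inj_on \<sigma> I"
    proof (rule inj_onI, rule ccontr)
      fix i j assume "i \<in> I" "j \<in> I" "\<sigma> i = \<sigma> j" "i \<noteq> j"
      with disj[of i j] \<sigma>[of i] \<sigma>[of j] show False by auto
    qed
    then have "sum w (\<sigma> ` I) = (\<Sum>i\<in>I. w (\<sigma> i))" by (simp add: sum.reindex)
    also have "\<dots> = (\<Sum>i\<in>I. min (w (a i)) (w (b i)) + (if i \<in> J then D i else 0))"
      by (intro sum.cong) (auto simp: \<sigma>_def hi_def lo_def D_def)
    also have "\<dots> = m + sum D J"
      using J(1) assms(1) by (simp add: sum.distrib m_def sum.If_cases Int_absorb1)
    finally have "v = sum w (\<sigma> ` I)" using J by simp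
    moreover have "\<sigma> ` I \<subseteq> a ` I \<union> b ` I" using \<sigma> by fastforce
    ultimately show "v \<in> sum w ` Pow (a ` I \<union> b ` I)" by blast
  qed
  moreover have "separated (real M * \<tau>) V'" using V(2) by (auto simp: V'_def separated_def)
  moreover have "card V' = card V" unfolding V'_def by (intro card_image) auto
  moreover have "x - y \<le> \<rho> * real (card I)" if "x \<in> V'" "y \<in> V'" for x y
  proof -
    obtain v v' where "v \<in> V" "v' \<in> V" "x = m + v" "y = m + v'" using \<open>x \<in> V'\<close> \<open>y \<in> V'\<close> unfolding V'_def by blast
    then have "x - y \<le> sum D I" using bspec[OF V(4), of v] bspec[OF V(4), of v'] by linarith
    also have "\<dots> \<le> (\<Sum>i\<in>I. \<rho>)" using diff by (intro sum_mono) (auto simp: D_def)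
    finally show ?thesis by (simp add: mult.commute)
  qed
  ultimately show ?thesis using V(3) by (intro exI[of _ V']) auto
qed

section \<open>Complete pairs in almost complete ones\<close>

text \<open>Choose the elements of \<open>B\<close> one at a time. Since at most half of \<open>W\<close> is ever used, a point of \<open>U\<close> misses at most
  a proportion \<open>2 \<eta>\<close> of the unused part of \<open>W\<close>; by averaging some unused element is missed by at most a
  proportion \<open>2 \<eta>\<close> of the points of \<open>U\<close> that are still alive.\<close>

lemma exists_biclique_of_few_misses:
  assumes "finite U" and "finite W" and "0 \<le> \<eta>" and "\<eta> \<le> 1 / 2"
    and "\<And>x. x \<in> U \<Longrightarrow> real (card {w \<in> W. x \<notin> N w}) \<le> \<eta> * real (card W)"
    and "2 * b \<le> card W"
  shows "\<exists>B\<subseteq>W. card B = b \<and> (1 - 2 * \<eta>) ^ b * real (card U) \<le> real (card {x \<in> U. \<forall>w\<in>B. x \<in> N w})"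
  using assms(6)
proof (induction b)
  case 0
  then show ?case by (intro exI[of _ "{}"]) simp
next
  case (Suc b)
  then obtain B where B: "B \<subseteq> W" "card B = b"
      "(1 - 2 * \<eta>) ^ b * real (card U) \<le> real (card {x \<in> U. \<forall>w\<in>B. x \<in> N w})"
    by auto
  define U' where "U' = {x \<in> U. \<forall>w\<in>B. x \<in> N w}"
  define R where "R = W - B"
  have fin: "finite U'" "finite R" "finite B" using assms(1,2) B finite_subset by (auto simp: U'_def R_def)
  have cR: "card W \<le> 2 * card R" "R \<noteq> {}"
  proof -
    have "card R = card W - b" using B fin by (simp add: R_def card_Diff_subset)
    with Suc.prems show "card W \<le> 2 * card R" by simp
    with Suc.prems show "R \<noteq> {}" by auto
  qed
  have "\<exists>w\<in>R. real (card {x \<in> U'. x \<notin> N w}) \<le> 2 * \<eta> * real (card U')"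
  proof (rule ccontr)
    assume neg: "\<not> ?thesis"
    have "real (card R) * (2 * \<eta> * real (card U')) = (\<Sum>w\<in>R. 2 * \<eta> * real (card U'))" by simp
    also have "\<dots> < (\<Sum>w\<in>R. real (card {x \<in> U'. x \<notin> N w}))"
      using neg fin cR by (intro sum_strict_mono) (auto simp: not_le)
    also have "\<dots> = (\<Sum>x\<in>U'. real (card {w \<in> R. x \<notin> N w}))"
      using fin by (intro sum_card_swap)
    also have "\<dots> \<le> (\<Sum>x\<in>U'. \<eta> * real (card W))"
    proof (rule sum_mono)
      fix x assume "x \<in> U'"
      then have "real (card {w \<in> W. x \<notin> N w}) \<le> \<eta> * real (card W)"
        using assms(5) by (simp add: U'_def)
      moreover have "card {w \<in> R. x \<notin> N w} \<le> card {w \<in> W. x \<notin> N w}"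
        using assms(2) by (intro card_mono) (auto simp: R_def)
      ultimately show "real (card {w \<in> R. x \<notin> N w}) \<le> \<eta> * real (card W)" by linarith
    qed
    also have "\<dots> = real (card U') * \<eta> * real (card W)" by simp
    also have "\<dots> \<le> real (card U') * \<eta> * real (2 * card R)"
      using cR assms(3) by (intro mult_left_mono) (auto simp del: of_nat_mult)
    finally show False by (simp add: mult_ac)
  qed
  then obtain w where w: "w \<in> R" "real (card {x \<in> U'. x \<notin> N w}) \<le> 2 * \<eta> * real (card U')" by blast
  have "card U' = card {x \<in> U'. x \<in> N w} + card {x \<in> U'. x \<notin> N w}"
  proof -
    have "U' = {x \<in> U'. x \<in> N w} \<union> {x \<in> U'. x \<notin> N w}" by auto
    then have "card U' = card ({x \<in> U'. x \<in> N w} \<union> {x \<in> U'. x \<notin> N w})" by simp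
    also have "\<dots> = card {x \<in> U'. x \<in> N w} + card {x \<in> U'. x \<notin> N w}"
      using fin by (intro card_Un_disjoint) auto
    finally show ?thesis .
  qed
  with w have "(1 - 2 * \<eta>) * real (card U') \<le> real (card {x \<in> U'. x \<in> N w})"
    by (simp add: algebra_simps)
  moreover have "(1 - 2 * \<eta>) * ((1 - 2 * \<eta>) ^ b * real (card U)) \<le> (1 - 2 * \<eta>) * real (card U')"
    using B(3) assms(4) by (intro mult_left_mono) (auto simp: U'_def)
  moreover have "{x \<in> U'. x \<in> N w} = {x \<in> U. \<forall>v\<in>insert w B. x \<in> N v}" by (auto simp: U'_def)
  moreover have "card (insert w B) = Suc b" "insert w B \<subseteq> W" using w B fin by (auto simp: R_def)
  ultimately show ?case by (intro exI[of _ "insert w B"]) (auto simp: mult_ac)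
qed

text \<open>On average a point of \<open>U\<close> misses a proportion \<open>\<epsilon>\<close> of \<open>W\<close>. Hence at least half of the points miss at most a
  proportion \<open>2 \<epsilon>\<close>, and the greedy choice is made for these.\<close>

lemma exists_biclique_of_near_complete:
  assumes "finite U" and "finite W" and "0 < \<epsilon>" and "\<epsilon> \<le> 1 / 8"
    and "\<And>w. w \<in> W \<Longrightarrow> real (card (U - N w)) \<le> \<epsilon> * real (card U)"
    and "2 * b \<le> card W"
  shows "\<exists>B\<subseteq>W. card B = b \<and> (1 - 4 * \<epsilon>) ^ b * (real (card U) / 2) \<le> real (card {x \<in> U. \<forall>w\<in>B. x \<in> N w})"
proof -
  define T where "T = {x \<in> U. real (card {w \<in> W. x \<notin> N w}) \<le> 2 * \<epsilon> * real (card W)}"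
  have T: "finite T" "T \<subseteq> U" using assms(1) by (auto simp: T_def)
  have half: "real (card U) / 2 \<le> real (card T)"
  proof (cases "W = {}")
    case True
    then have "T = U" by (auto simp: T_def)
    then show ?thesis by simp
  next
    case False
    then have cW: "real (card W) > 0" using assms(2) by (simp add: card_gt_0_iff)
    have "real (card (U - T)) * (2 * \<epsilon> * real (card W)) = (\<Sum>x\<in>U - T. 2 * \<epsilon> * real (card W))" by simp
    also have "\<dots> \<le> (\<Sum>x\<in>U - T. real (card {w \<in> W. x \<notin> N w}))"
      by (intro sum_mono) (auto simp: T_def)
    also have "\<dots> \<le> (\<Sum>x\<in>U. real (card {w \<in> W. x \<notin> N w}))"
      using assms(1) by (intro sum_mono2) auto
    also have "\<dots> = (\<Sum>w\<in>W. real (card (U - N w)))"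
      using assms by (subst sum_card_swap) (auto simp: set_diff_eq)
    also have "\<dots> \<le> (\<Sum>w\<in>W. \<epsilon> * real (card U))" using assms(5) by (intro sum_mono)
    also have "\<dots> = (\<epsilon> * real (card W)) * real (card U)" by simp
    finally have "(\<epsilon> * real (card W)) * (2 * real (card (U - T))) \<le> (\<epsilon> * real (card W)) * real (card U)"
      by (simp add: mult_ac)
    then have "2 * real (card (U - T)) \<le> real (card U)"
      using cW assms(3) by (simp add: mult_le_cancel_left_pos)
    moreover have "real (card U) = real (card T) + real (card (U - T))"
      using T assms(1) by (simp add: card_Diff_subset card_mono)
    ultimately show ?thesis by linarith
  qed
  have "real (card {w \<in> W. x \<notin> N w}) \<le> (2 * \<epsilon>) * real (card W)" if "x \<in> T" for x
    using that by (simp add: T_def)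
  from exists_biclique_of_few_misses[of T W "2 * \<epsilon>" N b, OF T(1) assms(2) _ _ this assms(6)]
  obtain B where B: "B \<subseteq> W" "card B = b"
      "(1 - 2 * (2 * \<epsilon>)) ^ b * real (card T) \<le> real (card {x \<in> T. \<forall>w\<in>B. x \<in> N w})"
    using assms(3,4) by auto
  have "(1 - 4 * \<epsilon>) ^ b * (real (card U) / 2) \<le> (1 - 4 * \<epsilon>) ^ b * real (card T)"
    using half assms(4) by (intro mult_left_mono) auto
  also have "\<dots> \<le> real (card {x \<in> T. \<forall>w\<in>B. x \<in> N w})" using B(3) by simp
  also have "\<dots> \<le> real (card {x \<in> U. \<forall>w\<in>B. x \<in> N w})"
    using T assms(1) by (simp, intro card_mono) auto
  finally show ?thesis using B by blast
qed

section \<open>Subset sums of degrees in rich bipartite graphs\<close>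

text \<open>What the proof uses of the Ramsey property: up to \<open>D\<close> exceptions, no vertex of \<open>Y\<close> is almost empty or almost
  complete to a set \<open>U\<close> of linear size. For Ramsey graphs \<open>D\<close> is logarithmic, so that \<open>D\<^sup>4\<close> is negligible against
  the scale \<open>r = \<surd>p\<close>. The proportion \<open>\<epsilon> / 4\<close> is the smallest one that occurs: it arises for \<open>U = N(y) - N(z)\<close>
  when \<open>y\<close> and \<open>z\<close> are not near-twins.\<close>

locale rich_bigraph =
  fixes X :: "'x set" and Y :: "'y set" and N :: "'y \<Rightarrow> 'x set" and \<epsilon> :: real and D :: nat
  assumes finite_X: "finite X" and finite_Y: "finite Y"
    and N_subset: "y \<in> Y \<Longrightarrow> N y \<subseteq> X"
    and eps_pos: "0 < \<epsilon>" and eps_le: "\<epsilon> \<le> 1 / 8" and D_pos: "0 < D"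
    and card_X_le: "card X \<le> card Y"
    and few_sparse: "U \<subseteq> X \<Longrightarrow> \<epsilon> / 4 * real (card X) \<le> real (card U) \<Longrightarrow>
      card {y \<in> Y. real (card (N y \<inter> U)) \<le> \<epsilon> * real (card U)} \<le> D"
    and few_dense: "U \<subseteq> X \<Longrightarrow> \<epsilon> / 4 * real (card X) \<le> real (card U) \<Longrightarrow>
      card {y \<in> Y. real (card (U - N y)) \<le> \<epsilon> * real (card U)} \<le> D"
    and D_small: "100 * real D ^ 4 \<le> sqrt (real (card X))"
    and X_large: "144 \<le> \<epsilon> * sqrt (real (card X))"
begin

abbreviation r :: real where "r \<equiv> sqrt (real (card X))"

definition near :: "'y \<Rightarrow> 'y \<Rightarrow> bool" where
  "near y z \<longleftrightarrow> real (card (N y - N z) + card (N z - N y)) \<le> \<epsilon> / 2 * real (card X)"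

definition deg :: "'x set \<Rightarrow> 'y \<Rightarrow> real" where
  "deg A y = real (card (N y \<inter> A))"

text \<open>The standard deviation of \<open>2 deg A y\<close> is at most \<open>r\<close>, so this has probability at most \<open>1 / 64\<close>
  (\<open>card_deviates_le\<close>).\<close>

definition deviates :: "'x set \<Rightarrow> 'y \<Rightarrow> bool" where
  "deviates A y \<longleftrightarrow> \<bar>2 * deg A y - real (card (N y))\<bar> > 8 * r"

lemma r_sq: "r * r = real (card X)" by simp

lemma r_ge: "r \<ge> 1152"
proof -
  have "\<epsilon> * r \<le> 1 / 8 * r" using eps_le by (intro mult_right_mono) auto
  then show ?thesis using X_large by linarith
qed

lemma card_X_pos: "0 < card X" using r_ge by (cases "card X = 0") auto

lemma D_le: "real D \<le> r / 100" "real D ^ 2 \<le> r / 100" "real D ^ 4 \<le> r / 100"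
proof -
  have "real D \<ge> 1" using D_pos by simp
  then have "real D ^ 1 \<le> real D ^ 4" "real D ^ 2 \<le> real D ^ 4" by (intro power_increasing; simp)+
  then show "real D \<le> r / 100" "real D ^ 2 \<le> r / 100" "real D ^ 4 \<le> r / 100"
    using D_small unfolding power_one_right by linarith+
qed

lemma near_refl: "near y y" using eps_pos by (simp add: near_def)

lemma near_sym: "near y z \<Longrightarrow> near z y" by (simp add: near_def add.commute)

text \<open>One of \<open>N y\<close> and its complement contains half of \<open>X\<close>. A near-twin of \<open>y\<close> is almost complete to the former and
  almost empty to the latter, so it is an exception for whichever of the two is large.\<close>

lemma card_near_le:
  assumes "y \<in> Y"
  shows "card {z \<in> Y. near y z} \<le> D"
proof -
  have Ny: "N y \<subseteq> X" using assms by (rule N_subset)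
  have split: "card X = card (N y) + card (X - N y)"
    using Ny finite_X by (metis card_Diff_subset card_mono le_add_diff_inverse rev_finite_subset)
  have small: "\<epsilon> / 4 * real (card X) \<le> real (card X) / 2"
    using eps_le mult_right_mono[of \<epsilon> 2 "real (card X)"] by simp
  have fin: "finite (N z - N y)" "finite (N y - N z)" if "z \<in> Y" for z
    using N_subset[OF that] Ny finite_X by (auto intro: finite_subset)
  have scale: "\<epsilon> / 2 * real (card X) \<le> \<epsilon> * u" if "real (card X) / 2 \<le> u" for u
    using that eps_pos mult_left_mono[of "real (card X) / 2" u \<epsilon>] by simp
  show ?thesis
  proof (cases "card X \<le> 2 * card (N y)")
    case True
    then have big: "real (card X) / 2 \<le> real (card (N y))" by simp
    have "real (card (N y - N z)) \<le> \<epsilon> * real (card (N y))" if "near y z" for z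
      using that scale[OF big] by (simp add: near_def)
    then have "card {z \<in> Y. near y z} \<le> card {z \<in> Y. real (card (N y - N z)) \<le> \<epsilon> * real (card (N y))}"
      using finite_Y by (intro card_mono) auto
    also have "\<dots> \<le> D" using big small Ny by (intro few_dense) auto
    finally show ?thesis .
  next
    case False
    then have big: "real (card X) / 2 \<le> real (card (X - N y))" using split by simp
    have "real (card (N z \<inter> (X - N y))) \<le> \<epsilon> * real (card (X - N y))" if "z \<in> Y" "near y z" for z
    proof -
      have "card (N z \<inter> (X - N y)) \<le> card (N z - N y)" using fin[OF that(1)] by (intro card_mono) auto
      then show ?thesis using that(2) scale[OF big] by (simp add: near_def)
    qed
    then have "card {z \<in> Y. near y z} \<le>
        card {z \<in> Y. real (card (N z \<inter> (X - N y))) \<le> \<epsilon> * real (card (X - N y))}"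
      using finite_Y by (intro card_mono) auto
    also have "\<dots> \<le> D" using big small by (intro few_sparse) auto
    finally show ?thesis .
  qed
qed

lemma card_deviates_le:
  assumes "y \<in> Y"
  shows "real (card {A \<in> Pow X. deviates A y}) \<le> 2 ^ card X / 64"
proof -
  have "real (card {A \<in> Pow X. deviates A y}) \<le> 2 ^ card X * real (card X) / (8 * r)\<^sup>2"
    unfolding deviates_def deg_def
    using finite_X N_subset[OF assms] card_X_pos by (intro card_large_deviation_le) auto
  also have "(8 * r)\<^sup>2 = 64 * real (card X)" by (simp add: power2_eq_square)
  finally show ?thesis using card_X_pos by simp
qed

text \<open>The Littlewood-Offord bound needs a constant \<open>|u|\<close>; one of the values 1 and 2 is taken on at least half of \<open>S\<close>.
  The constant comes from \<open>\<surd>8 \<le> 3\<close>.\<close>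

lemma card_sum_eq_le:
  fixes u :: "'x \<Rightarrow> int"
  assumes "S \<subseteq> X" and "\<epsilon>\<^sup>2 / 4 * real (card X) \<le> real (card S)"
    and "\<And>x. x \<in> S \<Longrightarrow> \<bar>u x\<bar> = 1 \<or> \<bar>u x\<bar> = 2"
  shows "real (card {A \<in> Pow X. sum u A = k}) \<le> 2 ^ card X * 3 / (\<epsilon> * r)"
proof -
  define S1 where "S1 = {x \<in> S. \<bar>u x\<bar> = 1}"
  define S2 where "S2 = {x \<in> S. \<bar>u x\<bar> = 2}"
  have finS: "finite S" using assms(1) finite_X finite_subset by blast
  have "S = S1 \<union> S2" using assms(3) by (auto simp: S1_def S2_def)
  then have "card S \<le> card S1 + card S2" by (metis card_Un_le)
  then have "real (card S1) \<ge> \<epsilon>\<^sup>2 / 8 * real (card X) \<or> real (card S2) \<ge> \<epsilon>\<^sup>2 / 8 * real (card X)"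
    using assms(2) by linarith
  then obtain T a where T: "T \<subseteq> X" "real (card T) \<ge> \<epsilon>\<^sup>2 / 8 * real (card X)"
      "(a::int) > 0" "\<And>x. x \<in> T \<Longrightarrow> \<bar>u x\<bar> = a"
  proof (elim disjE)
    assume *: "real (card S1) \<ge> \<epsilon>\<^sup>2 / 8 * real (card X)"
    show ?thesis using assms(1) by (intro that[OF _ *, of 1]) (auto simp: S1_def)
  next
    assume *: "real (card S2) \<ge> \<epsilon>\<^sup>2 / 8 * real (card X)"
    show ?thesis using assms(1) by (intro that[OF _ *, of 2]) (auto simp: S2_def)
  qed
  have pos: "\<epsilon>\<^sup>2 / 8 * real (card X) > 0" using eps_pos card_X_pos by simp
  have "T \<noteq> {}" "card T > 0" using pos T(2) by (auto intro: Nat.gr0I)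
  have "(\<epsilon> * r / 3)\<^sup>2 = \<epsilon>\<^sup>2 / 9 * real (card X)" by (simp add: power_mult_distrib power_divide)
  also have "\<dots> \<le> \<epsilon>\<^sup>2 / 8 * real (card X)" by (intro mult_right_mono) auto
  finally have "(\<epsilon> * r / 3)\<^sup>2 \<le> real (card T)" using T(2) by linarith
  then have "\<epsilon> * r / 3 \<le> sqrt (real (card T))" by (rule real_le_rsqrt)
  moreover have "0 < \<epsilon> * r / 3" using X_large by linarith
  ultimately have "2 ^ card X / sqrt (real (card T)) \<le> 2 ^ card X / (\<epsilon> * r / 3)"
    using \<open>card T > 0\<close> by (intro divide_left_mono mult_pos_pos) auto
  moreover have "real (card {A \<in> Pow X. sum u A = k}) \<le> 2 ^ card X / sqrt (real (card T))"
    using finite_X T \<open>T \<noteq> {}\<close> by (intro card_subset_sums_le[where a = a]) auto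
  ultimately show ?thesis by simp
qed

lemma deg_eq_sum: "A \<subseteq> X \<Longrightarrow> deg A y = of_int (\<Sum>x\<in>A. of_bool (x \<in> N y))"
  using finite_subset[OF _ finite_X, of A] by (simp add: deg_def Int_commute Int_def)

text \<open>The difference of the degrees is an integer, so being below \<open>\<tau> = \<epsilon> r / 144\<close> in absolute value leaves at most
  \<open>3 \<tau>\<close> possible values, each of probability at most \<open>3 / (\<epsilon> r)\<close>.\<close>

lemma card_close_degrees_le:
  assumes "y \<in> Y" and "z \<in> Y" and "\<not> near y z"
  shows "real (card {A \<in> Pow X. \<bar>deg A y - deg A z\<bar> < \<epsilon> * r / 144}) \<le> 2 ^ card X / 16"
proof -
  define \<tau> where "\<tau> = \<epsilon> * r / 144"
  have \<tau>: "\<tau> \<ge> 1" using X_large by (simp add: \<tau>_def)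
  define u :: "'x \<Rightarrow> int" where "u x = of_bool (x \<in> N y) - of_bool (x \<in> N z)" for x
  define S where "S = (N y - N z) \<union> (N z - N y)"
  let ?K = "{- \<lfloor>\<tau>\<rfloor>..\<lfloor>\<tau>\<rfloor>}"
  have S: "S \<subseteq> X" using N_subset assms(1,2) by (auto simp: S_def)
  have "card S = card (N y - N z) + card (N z - N y)"
    unfolding S_def using N_subset[OF assms(1)] N_subset[OF assms(2)] finite_X
    by (intro card_Un_disjoint) (auto intro: finite_subset)
  then have "\<epsilon> / 2 * real (card X) \<le> real (card S)" using assms(3) by (simp add: near_def)
  moreover have "\<epsilon>\<^sup>2 / 4 * real (card X) \<le> \<epsilon> / 2 * real (card X)"
    using eps_pos eps_le by (intro mult_right_mono) (auto simp: power2_eq_square mult_le_one)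
  ultimately have big: "\<epsilon>\<^sup>2 / 4 * real (card X) \<le> real (card S)" by linarith
  have "{A \<in> Pow X. \<bar>deg A y - deg A z\<bar> < \<tau>} \<subseteq> (\<Union>k\<in>?K. {A \<in> Pow X. sum u A = k})"
  proof
    fix A assume A: "A \<in> {A \<in> Pow X. \<bar>deg A y - deg A z\<bar> < \<tau>}"
    then have "deg A y - deg A z = of_int (sum u A)"
      by (simp add: deg_eq_sum u_def sum_subtractf)
    moreover define s where "s = sum u A"
    ultimately have "\<bar>real_of_int s\<bar> < \<tau>" using A by auto
    then have "s \<le> \<lfloor>\<tau>\<rfloor>" "- s \<le> \<lfloor>\<tau>\<rfloor>" unfolding le_floor_iff by linarith+
    then have "sum u A \<in> ?K" by (simp add: s_def)
    then show "A \<in> (\<Union>k\<in>?K. {A \<in> Pow X. sum u A = k})" using A by auto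
  qed
  then have "card {A \<in> Pow X. \<bar>deg A y - deg A z\<bar> < \<tau>} \<le> card (\<Union>k\<in>?K. {A \<in> Pow X. sum u A = k})"
    using finite_X by (intro card_mono) auto
  also have "\<dots> \<le> (\<Sum>k\<in>?K. card {A \<in> Pow X. sum u A = k})"
    using finite_X by (intro card_UN_le) auto
  finally have "real (card {A \<in> Pow X. \<bar>deg A y - deg A z\<bar> < \<tau>}) \<le>
      (\<Sum>k\<in>?K. real (card {A \<in> Pow X. sum u A = k}))"
    by (simp flip: of_nat_sum)
  also have "\<dots> \<le> (\<Sum>k\<in>?K. 2 ^ card X * 3 / (\<epsilon> * r))"
    using S big by (intro sum_mono card_sum_eq_le[of S]) (auto simp: u_def S_def)
  also have "\<dots> = real (card ?K) * (2 ^ card X * 3 / (\<epsilon> * r))" by simp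
  also have "\<dots> \<le> (3 * \<tau>) * (2 ^ card X * 3 / (\<epsilon> * r))"
  proof (rule mult_right_mono)
    show "real (card ?K) \<le> 3 * \<tau>" using \<tau> by (simp, linarith)
    show "0 \<le> 2 ^ card X * 3 / (\<epsilon> * r)" using X_large by simp
  qed
  also have "\<dots> = 2 ^ card X / 16"
    using eps_pos card_X_pos by (simp add: \<tau>_def field_simps)
  finally show ?thesis by (simp add: \<tau>_def)
qed

text \<open>Inside a set of vertices that are pairwise not near-twins choose \<open>Z1\<close> of size \<open>D\<close>, and \<open>Z2\<close> among the rest,
  avoiding the vertices that are almost empty to some large set \<open>N(y) - N(y')\<close> with \<open>y, y' \<in> Z1\<close>. This
  excludes only \<open>D\<^sup>3\<close> vertices. Consider the difference \<open>u\<close> of the vectors \<open>1\<^bsub>N(y)\<^esub> + 1\<^bsub>N(z)\<^esub>\<close> and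
  \<open>1\<^bsub>N(y')\<^esub> + 1\<^bsub>N(z')\<^esub>\<close>. If the pairs share a vertex, \<open>u\<close> is nonzero where the neighbourhoods of the other two
  vertices differ. Otherwise one of \<open>N(y) - N(y')\<close> and \<open>N(y') - N(y)\<close> is large. On the first set
  \<open>u = 1 + 1\<^bsub>N(z)\<^esub> - 1\<^bsub>N(z')\<^esub>\<close>, which is at least 1 at all the points of \<open>N(z)\<close>, and there are many such points by
  the choice of \<open>Z2\<close>; the second case is symmetric, with \<open>z'\<close> and \<open>- u\<close>.\<close>

lemma exists_sum_distinguished_pairs:
  assumes "Z \<subseteq> Y" and "r / 2 \<le> real (card Z)" and "real k \<le> r / 384"
  shows "\<exists>Z1 Z2 P. Z1 \<subseteq> Z \<and> Z2 \<subseteq> Z \<and> Z1 \<inter> Z2 = {} \<and> real (card (Z1 \<union> Z2)) \<le> r / 8 \<and>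
    P \<subseteq> Z1 \<times> Z2 \<and> card P = k \<and>
    (\<forall>\<pi>\<in>P. \<forall>\<pi>'\<in>P. \<pi> \<noteq> \<pi>' \<longrightarrow>
      real (card {A \<in> Pow X. deg A (fst \<pi>) + deg A (snd \<pi>) = deg A (fst \<pi>') + deg A (snd \<pi>')})
        \<le> 2 ^ card X * 3 / (\<epsilon> * r))"
proof -
  have finZ: "finite Z" using assms(1) finite_Y finite_subset by blast
  have nearD: "card {z \<in> Z. near y z} \<le> D" if "y \<in> Z" for y
    using that assms(1) finite_Y
    by (intro order_trans[OF card_mono card_near_le[of y]]) auto
  obtain T where T: "T \<subseteq> Z" "card Z \<le> D * card T" "\<forall>x\<in>T. \<forall>y\<in>T. x \<noteq> y \<longrightarrow> \<not> near x y"
    using exists_independent_subset[of Z near D] finZ near_refl near_sym nearD by blast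
  have cT: "r / 2 \<le> real D * real (card T)"
    using assms(2) T(2) by (metis of_nat_le_iff of_nat_mult order_trans)
  have "real D * real D \<le> real D * real (card T)"
    using cT D_le(2) r_ge by (simp add: power2_eq_square)
  then have "D \<le> card T" using D_pos by (simp add: mult_le_cancel_left)
  then obtain Z1 where Z1: "Z1 \<subseteq> T" "card Z1 = D" "finite Z1"
    by (meson obtain_subset_with_card_n)
  \<comment> \<open>\<open>F\<close> collects the vertices that \<open>Z2\<close> has to avoid.\<close>
  define I where "I = {\<pi> \<in> Z1 \<times> Z1. \<epsilon> / 4 * real (card X) \<le> real (card (N (fst \<pi>) - N (snd \<pi>)))}"
  define Q where "Q \<pi> = {v \<in> Y. real (card (N v \<inter> (N (fst \<pi>) - N (snd \<pi>))))
      \<le> \<epsilon> * real (card (N (fst \<pi>) - N (snd \<pi>)))}" for \<pi>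
  define F where "F = (\<Union>\<pi>\<in>I. Q \<pi>)"
  have finI: "finite I" using Z1(3) by (simp add: I_def)
  have Z1Y: "Z1 \<subseteq> Y" using Z1 T assms(1) by auto
  have "card (Q \<pi>) \<le> D" if "\<pi> \<in> I" for \<pi>
    unfolding Q_def
  proof (rule few_sparse)
    have "fst \<pi> \<in> Y" using that Z1Y by (auto simp: I_def)
    from N_subset[OF this] show "N (fst \<pi>) - N (snd \<pi>) \<subseteq> X" by blast
  qed (use that in \<open>simp add: I_def\<close>)
  then have "(\<Sum>\<pi>\<in>I. card (Q \<pi>)) \<le> (\<Sum>\<pi>\<in>I. D)" by (rule sum_mono)
  moreover have "card F \<le> (\<Sum>\<pi>\<in>I. card (Q \<pi>))" unfolding F_def using finI by (rule card_UN_le)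
  moreover have "card I \<le> card (Z1 \<times> Z1)" using Z1(3) by (intro card_mono) (auto simp: I_def)
  then have "card I * D \<le> (D * D) * D" using Z1(2) by (simp add: card_cartesian_product)
  ultimately have cF: "card F \<le> D ^ 3" unfolding power3_eq_cube sum_constant of_nat_id by linarith
  have finF: "finite F" unfolding F_def Q_def using finI finite_Y by auto
  define m where "m = k div D + 1"
  have cT2: "m \<le> card (T - Z1 - F)"
  proof -
    have "card T - D - D ^ 3 \<le> card (T - Z1 - F)"
      using diff_card_le_card_Diff[OF finF, of "T - Z1"] Z1 cF by (simp add: card_Diff_subset)
    moreover have "m + D + D ^ 3 \<le> card T"
    proof -
      have "D * m \<le> k + D" by (simp add: m_def algebra_simps)
      then have "real D * real m \<le> real k + real D" by (metis of_nat_add of_nat_le_iff of_nat_mult)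
      then have "real D * (real m + real D + real D ^ 3) \<le> real k + real D + real D ^ 2 + real D ^ 4"
        by (simp add: algebra_simps power2_eq_square power3_eq_cube power4_eq_xxxx)
      also have "\<dots> \<le> real D * real (card T)" using cT D_le assms(3) r_ge by linarith
      finally have "real m + real D + real D ^ 3 \<le> real (card T)"
        using D_pos by (simp add: mult_le_cancel_left)
      then show ?thesis by (metis of_nat_add of_nat_le_iff of_nat_power)
    qed
    ultimately show ?thesis by linarith
  qed
  then obtain Z2 where Z2: "Z2 \<subseteq> T - Z1 - F" "card Z2 = m" "finite Z2"
    by (meson obtain_subset_with_card_n)
  have "k \<le> D * m"
    using D_pos by (simp add: m_def) (metis dividend_less_times_div less_imp_le mult.commute mult_Suc_right)
  then have "k \<le> card (Z1 \<times> Z2)" using Z1 Z2 by (simp add: card_cartesian_product)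
  then obtain P where P: "P \<subseteq> Z1 \<times> Z2" "card P = k" by (meson obtain_subset_with_card_n)
  have "real m \<le> real k + 1"
    by (simp add: m_def)
  then have cZ: "real (card (Z1 \<union> Z2)) \<le> r / 8"
    using card_Un_le[of Z1 Z2] Z1(2) Z2(2) D_le(1) assms(3) r_ge by linarith
  have collide: "real (card {A \<in> Pow X. deg A y + deg A z = deg A y' + deg A z'}) \<le> 2 ^ card X * 3 / (\<epsilon> * r)"
    if "(y, z) \<in> P" "(y', z') \<in> P" "(y, z) \<noteq> (y', z')" for y z y' z'
  proof -
    have yz: "y \<in> Z1" "z \<in> Z2" "y' \<in> Z1" "z' \<in> Z2" using that P(1) by auto
    have ne: "(y, z) \<noteq> (y', z')" using that by blast
    from yz have inT: "y \<in> T" "y' \<in> T" "z \<in> T" "z' \<in> T" "z \<notin> F" "z' \<notin> F" using Z1 Z2 by auto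
    then have inY: "y \<in> Y" "y' \<in> Y" "z \<in> Y" "z' \<in> Y" using T(1) assms(1) by auto
    note sub = N_subset[OF inY(1)] N_subset[OF inY(2)] N_subset[OF inY(3)] N_subset[OF inY(4)]
    define u :: "'x \<Rightarrow> int" where
      "u x = of_bool (x \<in> N y) + of_bool (x \<in> N z) - of_bool (x \<in> N y') - of_bool (x \<in> N z')" for x
    have key: "{A \<in> Pow X. deg A y + deg A z = deg A y' + deg A z'} = {A \<in> Pow X. sum u A = 0}"
    proof -
      have "deg A y + deg A z - deg A y' - deg A z' = of_int (sum u A)" if "A \<subseteq> X" for A
        using that by (simp add: deg_eq_sum u_def sum_subtractf sum.distrib)
      then have "deg A y + deg A z = deg A y' + deg A z' \<longleftrightarrow> sum u A = 0" if "A \<subseteq> X" for A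
        using that by (smt (verit) of_int_0_eq_iff)
      then show ?thesis by auto
    qed
    have small: "\<epsilon>\<^sup>2 / 4 * real (card X) \<le> \<epsilon> / 2 * real (card X)"
      using eps_pos eps_le by (intro mult_right_mono) (auto simp: power2_eq_square mult_le_one)
    have symm: "\<epsilon>\<^sup>2 / 4 * real (card X) \<le> real (card ((N v - N w) \<union> (N w - N v)))"
      if "v \<in> T" "w \<in> T" "v \<noteq> w" for v w
    proof -
      have "v \<in> Y" "w \<in> Y" using that T(1) assms(1) by auto
      then have "card ((N v - N w) \<union> (N w - N v)) = card (N v - N w) + card (N w - N v)"
        using N_subset[of v] N_subset[of w] finite_X
        by (intro card_Un_disjoint) (auto intro: finite_subset)
      moreover have "\<not> near v w" using T(3) that by blast
      ultimately show ?thesis using small unfolding near_def by linarith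
    qed
    have cubic: "\<epsilon>\<^sup>2 / 4 * real (card X) \<le> real (card (N t \<inter> (N v - N w)))"
      if "v \<in> Z1" "w \<in> Z1" "t \<in> Y" "t \<notin> F" "\<epsilon> / 4 * real (card X) \<le> real (card (N v - N w))" for v w t
    proof -
      have "(v, w) \<in> I" using that by (simp add: I_def)
      then have "t \<notin> Q (v, w)" using that(4) by (auto simp: F_def)
      then have "\<epsilon> * real (card (N v - N w)) < real (card (N t \<inter> (N v - N w)))"
        using that(3) by (simp add: Q_def)
      moreover have "\<epsilon> * (\<epsilon> / 4 * real (card X)) \<le> \<epsilon> * real (card (N v - N w))"
        using that(5) eps_pos by (intro mult_left_mono) auto
      ultimately show ?thesis by (simp add: power2_eq_square)
    qed
    consider "y = y'" "z \<noteq> z'" | "z = z'" "y \<noteq> y'" | "y \<noteq> y'" "z \<noteq> z'"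
      using ne by auto
    then show ?thesis
    proof cases
      case 1
      show ?thesis unfolding key
        by (rule card_sum_eq_le[OF _ symm[of z z']]) (use 1 inT sub in \<open>auto simp: u_def\<close>)
    next
      case 2
      show ?thesis unfolding key
        by (rule card_sum_eq_le[OF _ symm[of y y']]) (use 2 inT sub in \<open>auto simp: u_def\<close>)
    next
      case 3
      then have "\<not> near y y'" using T(3) inT by blast
      then consider "\<epsilon> / 4 * real (card X) \<le> real (card (N y - N y'))"
        | "\<epsilon> / 4 * real (card X) \<le> real (card (N y' - N y))"
        unfolding near_def by fastforce
      then show ?thesis
      proof cases
        case 1
        show ?thesis unfolding key
          by (rule card_sum_eq_le[OF _ cubic[OF yz(1,3) inY(3) inT(5) 1]])
            (use sub in \<open>auto simp: u_def\<close>)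
      next
        case 2
        show ?thesis unfolding key
          by (rule card_sum_eq_le[OF _ cubic[OF yz(3,1) inY(4) inT(6) 2]])
            (use sub in \<open>auto simp: u_def\<close>)
      qed
    qed
  qed
  have "real (card {A \<in> Pow X. deg A (fst \<pi>) + deg A (snd \<pi>) = deg A (fst \<pi>') + deg A (snd \<pi>')})
      \<le> 2 ^ card X * 3 / (\<epsilon> * r)" if "\<pi> \<in> P" "\<pi>' \<in> P" "\<pi> \<noteq> \<pi>'" for \<pi> \<pi>'
    using collide[of "fst \<pi>" "snd \<pi>" "fst \<pi>'" "snd \<pi>'"] that by simp
  moreover have "Z1 \<subseteq> Z" "Z2 \<subseteq> Z" "Z1 \<inter> Z2 = {}" using Z1 Z2 T by auto
  ultimately show ?thesis using P cZ by (intro exI[of _ Z1] exI[of _ Z2] exI[of _ P]) simp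
qed

lemma card_either_deviates_or_le:
  assumes "y \<in> Y" and "z \<in> Y"
  shows "real (card {A \<in> Pow X. deviates A y \<or> deviates A z \<or> Q A}) \<le>
    2 ^ card X / 32 + real (card {A \<in> Pow X. Q A})"
proof -
  have "{A \<in> Pow X. deviates A y \<or> deviates A z \<or> Q A} =
      {A \<in> Pow X. deviates A y} \<union> {A \<in> Pow X. deviates A z} \<union> {A \<in> Pow X. Q A}" by auto
  then have "card {A \<in> Pow X. deviates A y \<or> deviates A z \<or> Q A} \<le>
      card {A \<in> Pow X. deviates A y} + card {A \<in> Pow X. deviates A z} + card {A \<in> Pow X. Q A}"
    by (metis (no_types, lifting) add_le_mono1 card_Un_le order_trans)
  then show ?thesis using card_deviates_le[OF assms(1)] card_deviates_le[OF assms(2)] by linarith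
qed

text \<open>The three scales are put together here. The random set \<open>A\<close> has to satisfy three requirements at once: most
  coarse vertices do not deviate; most middle pairs neither deviate nor have close degrees; and most fine pairs
  neither deviate nor collide. In each case the expected number of failures is at most a sixth of the number of
  vertices or pairs concerned.

  The sizes are \<open>s \<approx> \<epsilon> r / 72\<close> middle pairs and \<open>k \<approx> \<epsilon> r / 48\<close> fine pairs. The fine sums lie in a window of
  length \<open>17 r\<close>; the middle differences lie between \<open>\<epsilon> r / 144\<close> and \<open>9 r\<close>, so \<open>M \<approx> 2592 / \<epsilon>\<close> of them together
  exceed \<open>18 r\<close>, and all of them together stay below \<open>\<epsilon> p / 8\<close>, half of the gap \<open>\<epsilon> p / 4\<close> of the coarse sums. The
  constant is \<open>221184 = 4 \<cdot> 288 \<cdot> 192\<close>, one factor for each scale.\<close>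

lemma many_subset_sums:
  "\<exists>A\<subseteq>X. \<epsilon>\<^sup>2 / (221184 * real (nat \<lceil>2592 / \<epsilon>\<rceil>)) * real (card X * card Y) \<le> real (card (sum (deg A) ` Pow Y))"
proof -
  define k where "k = nat \<lfloor>\<epsilon> * r / 48\<rfloor>"
  define s where "s = nat \<lfloor>\<epsilon> * r / 72\<rfloor>"
  define M where "M = nat \<lceil>2592 / \<epsilon>\<rceil>"
  have eps_r: "\<epsilon> * r \<le> r / 8" using eps_le r_ge mult_right_mono[of \<epsilon> "1/8" r] by simp
  have k: "\<epsilon> * r / 96 \<le> real k" "real k \<le> \<epsilon> * r / 48" "0 < k" "real k \<le> r / 384"
    using X_large eps_r by (auto simp: k_def) linarith+
  have s: "\<epsilon> * r / 144 \<le> real s" "real s \<le> \<epsilon> * r / 72" "0 < s" "real s \<le> r / 576"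
    using X_large eps_r by (auto simp: s_def) linarith+
  have M: "2592 / \<epsilon> \<le> real M" unfolding M_def by linarith
  moreover have "0 < 2592 / \<epsilon>" using eps_pos by simp
  ultimately have M_pos: "0 < M" by (intro Nat.gr0I) auto
  have r2: "r \<le> real (card X)"
  proof -
    have "1 \<le> r" using r_ge by linarith
    then have "1 * r \<le> r * r" by (rule mult_right_mono) simp
    then show ?thesis unfolding r_sq by linarith
  qed
  obtain Z where Z: "Z \<subseteq> Y" "r / 2 \<le> real (card Z)"
      "\<forall>y\<in>Z. \<forall>z\<in>Z. \<bar>real (card (N y)) - real (card (N z))\<bar> \<le> r"
    using exists_large_bucket[OF finite_Y card_X_pos card_X_le, of "\<lambda>y. card (N y)"]
      N_subset finite_X by (auto simp: card_mono)
  have finZ: "finite Z" using Z(1) finite_Y finite_subset by blast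
  obtain Z1 Z2 P where P: "Z1 \<subseteq> Z" "Z2 \<subseteq> Z" "Z1 \<inter> Z2 = {}" "real (card (Z1 \<union> Z2)) \<le> r / 8"
      "P \<subseteq> Z1 \<times> Z2" "card P = k"
      "\<forall>\<pi>\<in>P. \<forall>\<pi>'\<in>P. \<pi> \<noteq> \<pi>' \<longrightarrow>
      real (card {A \<in> Pow X. deg A (fst \<pi>) + deg A (snd \<pi>) = deg A (fst \<pi>') + deg A (snd \<pi>')})
        \<le> 2 ^ card X * 3 / (\<epsilon> * r)"
    using exists_sum_distinguished_pairs[OF Z(1,2) k(4)] by blast
  have finP: "finite P" using P(6) k(3) card_ge_0_finite by metis
  define W where "W = Z - (Z1 \<union> Z2)"
  have "2 * s + D \<le> card W"
  proof -
    have "card W = card Z - card (Z1 \<union> Z2)"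
      unfolding W_def using P(1,2) finZ by (intro card_Diff_subset) (auto intro: finite_subset)
    then have "real (card W) \<ge> real (card Z) - real (card (Z1 \<union> Z2))" by linarith
    then have "real (2 * s + D) \<le> real (card W)" using s(4) D_le(1) Z(2) P(4) r_ge by simp
    then show ?thesis by linarith
  qed
  moreover have "card {z \<in> W. near y z} \<le> D" if "y \<in> W" for y
    using that Z(1) finite_Y by (intro order_trans[OF card_mono card_near_le[of y]]) (auto simp: W_def)
  ultimately obtain a b where ab: "\<forall>i<s. a i \<in> W \<and> b i \<in> W \<and> \<not> near (a i) (b i)"
      "\<forall>i<s. \<forall>j<s. i \<noteq> j \<longrightarrow> {a i, b i} \<inter> {a j, b j} = {}"
    using exists_disjoint_unrelated_pairs[of W near D s] finZ near_refl unfolding W_def by blast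
  define T where "T = a ` {..<s} \<union> b ` {..<s}"
  have T: "T \<subseteq> W" "finite T" using ab(1) by (auto simp: T_def)
  have WY: "W \<subseteq> Y" using Z(1) by (auto simp: W_def)
  define U where "U = Z1 \<union> Z2 \<union> T"
  have cU: "real (card U) \<le> r / 4"
  proof -
    have "card T \<le> card (a ` {..<s}) + card (b ` {..<s})" unfolding T_def by (rule card_Un_le)
    also have "\<dots> \<le> 2 * s" using card_image_le[of "{..<s}" a] card_image_le[of "{..<s}" b] by simp
    finally have "real (card T) \<le> 2 * real s" by simp
    moreover have "card U \<le> card (Z1 \<union> Z2) + card T" unfolding U_def by (rule card_Un_le)
    ultimately show ?thesis using P(4) s(4) r_ge by linarith
  qed
  have finU: "finite U" using T(2) P(1,2) finZ by (auto simp: U_def intro: finite_subset)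
  \<comment> \<open>The coarse vertices avoid \<open>U\<close>, the vertices reserved for the other two scales.\<close>
  define B where "B = {y \<in> Y - U. \<epsilon> * real (card X) < real (card (N y))}"
  have finB: "finite B" using finite_Y by (simp add: B_def)
  have cB: "real (card Y) / 2 \<le> real (card B)"
  proof -
    have "Y \<subseteq> B \<union> U \<union> {y \<in> Y. real (card (N y \<inter> X)) \<le> \<epsilon> * real (card X)}"
      using N_subset by (auto simp: B_def Int_absorb2)
    then have "card Y \<le> card (B \<union> U \<union> {y \<in> Y. real (card (N y \<inter> X)) \<le> \<epsilon> * real (card X)})"
      using finB finU finite_Y by (intro card_mono) auto
    also have "\<dots> \<le> card B + card U + card {y \<in> Y. real (card (N y \<inter> X)) \<le> \<epsilon> * real (card X)}"
      by (metis (no_types, lifting) add_le_mono1 card_Un_le order_trans)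
    also have "card {y \<in> Y. real (card (N y \<inter> X)) \<le> \<epsilon> * real (card X)} \<le> D"
      using eps_le mult_right_mono[of "\<epsilon> / 4" 1 "real (card X)"] by (intro few_sparse) auto
    finally have "real (card Y) \<le> real (card B) + real (card U) + real D" by linarith
    moreover have "r \<le> real (card Y)" using r2 card_X_le by linarith
    ultimately show ?thesis using cU D_le(1) by linarith
  qed
  have Y_pos: "real (card Y) > 0" using card_X_pos card_X_le by simp

  \<comment> \<open>The numbers of failures of the three requirements, as functions of \<open>A\<close>.\<close>
  define f1 where "f1 A = real (card {y \<in> B. deviates A y})" for A
  define bad2 where "bad2 A i \<longleftrightarrow> deviates A (a i) \<or> deviates A (b i) \<or>
    \<bar>deg A (a i) - deg A (b i)\<bar> < \<epsilon> * r / 144" for A i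
  define f2 where "f2 A = real (card {i \<in> {..<s}. bad2 A i})" for A
  define g where "g A \<pi> = deg A (fst \<pi>) + deg A (snd \<pi>)" for A \<pi>
  define bad3 where "bad3 A \<pi> \<longleftrightarrow> deviates A (fst \<pi>) \<or> deviates A (snd \<pi>) \<or> False" for A \<pi>
  define PP where "PP = {\<pi> \<in> P \<times> P. fst \<pi> \<noteq> snd \<pi>}"
  define f3 where "f3 A = real (card {\<pi> \<in> P. bad3 A \<pi>}) +
    real (card {\<pi> \<in> PP. g A (fst \<pi>) = g A (snd \<pi>)})" for A
  have finPP: "finite PP" using finP by (simp add: PP_def)
  have cPow: "real (card (Pow X)) = 2 ^ card X" using finite_X by (simp add: card_Pow)
  have PZ: "fst \<pi> \<in> Z1" "snd \<pi> \<in> Z2" if "\<pi> \<in> P" for \<pi> using that P(5) by auto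
  have ZY: "Z1 \<subseteq> Y" "Z2 \<subseteq> Y" using P(1,2) Z(1) by auto

  have e1: "sum f1 (Pow X) \<le> card (Pow X) * real (card B) / 6"
  proof -
    have "sum f1 (Pow X) = (\<Sum>y\<in>B. real (card {A \<in> Pow X. deviates A y}))"
      unfolding f1_def using finite_X finB by (intro sum_card_swap) auto
    also have "\<dots> \<le> (\<Sum>y\<in>B. 2 ^ card X / 64)"
      by (intro sum_mono card_deviates_le) (auto simp: B_def)
    also have "\<dots> \<le> 2 ^ card X * real (card B) / 6" by (simp add: field_simps)
    finally show ?thesis by (simp add: cPow)
  qed
  have e2: "sum f2 (Pow X) \<le> card (Pow X) * real s / 6"
  proof -
    have "sum f2 (Pow X) = (\<Sum>i\<in>{..<s}. real (card {A \<in> Pow X. bad2 A i}))"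
      unfolding f2_def using finite_X by (intro sum_card_swap) auto
    also have "\<dots> \<le> (\<Sum>i\<in>{..<s}. 2 ^ card X / 32 + 2 ^ card X / 16)"
    proof (rule sum_mono)
      fix i assume "i \<in> {..<s}"
      then have i: "a i \<in> Y" "b i \<in> Y" "\<not> near (a i) (b i)" using ab(1) WY by auto
      show "real (card {A \<in> Pow X. bad2 A i}) \<le> 2 ^ card X / 32 + 2 ^ card X / 16"
        unfolding bad2_def
        using card_either_deviates_or_le[OF i(1,2), of "\<lambda>A. \<bar>deg A (a i) - deg A (b i)\<bar> < \<epsilon> * r / 144"]
          card_close_degrees_le[OF i] by linarith
    qed
    also have "\<dots> \<le> 2 ^ card X * real s / 6" by (simp add: field_simps)
    finally show ?thesis by (simp add: cPow)
  qed
  have e3: "sum f3 (Pow X) \<le> card (Pow X) * real k / 6"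
  proof -
    have "(\<Sum>A\<in>Pow X. real (card {\<pi> \<in> P. bad3 A \<pi>})) = (\<Sum>\<pi>\<in>P. real (card {A \<in> Pow X. bad3 A \<pi>}))"
      using finite_X finP by (intro sum_card_swap) auto
    also have "\<dots> \<le> (\<Sum>\<pi>\<in>P. 2 ^ card X / 32)"
    proof (rule sum_mono)
      fix \<pi> assume "\<pi> \<in> P"
      then have "fst \<pi> \<in> Y" "snd \<pi> \<in> Y" using PZ[of \<pi>] ZY by blast+
      from card_either_deviates_or_le[OF this, of "\<lambda>A. False"]
      show "real (card {A \<in> Pow X. bad3 A \<pi>}) \<le> 2 ^ card X / 32" by (simp add: bad3_def)
    qed
    also have "\<dots> = 2 ^ card X * real k / 32" using P(6) by simp
    finally have 1: "(\<Sum>A\<in>Pow X. real (card {\<pi> \<in> P. bad3 A \<pi>})) \<le> 2 ^ card X * real k / 32" .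
    have "(\<Sum>A\<in>Pow X. real (card {\<pi> \<in> PP. g A (fst \<pi>) = g A (snd \<pi>)})) =
        (\<Sum>\<pi>\<in>PP. real (card {A \<in> Pow X. g A (fst \<pi>) = g A (snd \<pi>)}))"
      using finite_X finPP by (intro sum_card_swap) auto
    also have "\<dots> \<le> (\<Sum>\<pi>\<in>PP. 2 ^ card X * 3 / (\<epsilon> * r))"
    proof (rule sum_mono)
      fix \<pi> assume "\<pi> \<in> PP"
      then have "fst \<pi> \<in> P" "snd \<pi> \<in> P" "fst \<pi> \<noteq> snd \<pi>" by (auto simp: PP_def)
      from P(7)[rule_format, OF this]
      show "real (card {A \<in> Pow X. g A (fst \<pi>) = g A (snd \<pi>)}) \<le> 2 ^ card X * 3 / (\<epsilon> * r)"
        unfolding g_def .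
    qed
    also have "\<dots> = real (card PP) * (2 ^ card X * 3 / (\<epsilon> * r))" by simp
    also have "\<dots> \<le> (real k * real k) * (2 ^ card X * 3 / (\<epsilon> * r))"
    proof (rule mult_right_mono)
      have "card PP \<le> card (P \<times> P)" using finP by (intro card_mono) (auto simp: PP_def)
      then show "real (card PP) \<le> real k * real k"
        using P(6) by (simp add: card_cartesian_product flip: of_nat_mult)
      show "0 \<le> 2 ^ card X * 3 / (\<epsilon> * r)" using X_large by (intro divide_nonneg_nonneg) auto
    qed
    also have "\<dots> = (2 ^ card X * real k * 3 / (\<epsilon> * r)) * real k" by simp
    also have "\<dots> \<le> (2 ^ card X * real k * 3 / (\<epsilon> * r)) * (\<epsilon> * r / 48)"
      using k(2) X_large by (intro mult_left_mono divide_nonneg_nonneg) auto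
    also have "\<dots> = 2 ^ card X * real k / 16" using eps_pos card_X_pos by (simp add: field_simps)
    finally have 2: "(\<Sum>A\<in>Pow X. real (card {\<pi> \<in> PP. g A (fst \<pi>) = g A (snd \<pi>)})) \<le> 2 ^ card X * real k / 16" .
    have "sum f3 (Pow X) \<le> 2 ^ card X * real k / 32 + 2 ^ card X * real k / 16"
      using 1 2 unfolding f3_def sum.distrib by linarith
    also have "\<dots> \<le> 2 ^ card X * real k / 6" by (simp add: field_simps)
    finally show ?thesis by (simp add: cPow)
  qed
  have "\<exists>A\<in>Pow X. f1 A \<le> real (card B) / 2 \<and> f2 A \<le> real s / 2 \<and> f3 A \<le> real k / 2"
  proof (rule exists_simultaneously_small[OF _ _ _ _ _ _ e1 e2 e3])
    show "0 < real (card B)" using cB Y_pos by linarith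
  qed (use finite_X s(3) k(3) in \<open>auto simp: f1_def f2_def f3_def\<close>)
  then obtain A where A: "A \<subseteq> X" "f1 A \<le> real (card B) / 2" "f2 A \<le> real s / 2" "f3 A \<le> real k / 2"
    by blast

  \<comment> \<open>From here on \<open>A\<close> is fixed; first the coarse sums.\<close>
  define G where "G = \<epsilon> * real (card X) / 4"
  have Gr: "G = \<epsilon> * r * r / 4" by (simp add: G_def mult.assoc)
  have G: "36 * r \<le> G" using mult_right_mono[OF X_large, of r] by (simp add: Gr)
  have dev: "\<bar>2 * deg A y - real (card (N y))\<bar> \<le> 8 * r" if "\<not> deviates A y" for y
    using that by (simp add: deviates_def)

  define B' where "B' = {y \<in> B. \<not> deviates A y}"
  have "real (card B) / 2 \<le> real (card B')"
  proof -
    have "B = B' \<union> {y \<in> B. deviates A y}" by (auto simp: B'_def)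
    then have "card B \<le> card B' + card {y \<in> B. deviates A y}" by (metis card_Un_le)
    then show ?thesis using A(2) by (simp add: f1_def)
  qed
  moreover have "G \<le> deg A y" if "y \<in> B'" for y
  proof -
    have "\<epsilon> * real (card X) < real (card (N y))" "\<not> deviates A y" using that by (auto simp: B'_def B_def)
    with dev[of y] G show ?thesis unfolding G_def by linarith
  qed
  moreover have "finite B'" using finB by (simp add: B'_def)
  ultimately obtain V1 where V1: "V1 \<subseteq> sum (deg A) ` Pow B'" "separated G V1" "real (card Y) / 4 \<le> real (card V1)"
    using exists_separated_subset_sums[of B' G "deg A" 1] cB G r_ge by force

  \<comment> \<open>The middle sums.\<close>
  define I where "I = {i \<in> {..<s}. \<not> bad2 A i}"
  have I: "real s / 2 \<le> real (card I)" "card I \<le> s"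
  proof -
    have "{..<s} = I \<union> {i \<in> {..<s}. bad2 A i}" by (auto simp: I_def)
    then have "card {..<s} \<le> card I + card {i \<in> {..<s}. bad2 A i}" by (metis card_Un_le)
    then show "real s / 2 \<le> real (card I)" using A(3) by (simp add: f2_def)
    have "card I \<le> card {..<s}" by (intro card_mono) (auto simp: I_def)
    then show "card I \<le> s" by simp
  qed
  have "\<epsilon> * r / 144 \<le> \<bar>deg A (a i) - deg A (b i)\<bar> \<and> \<bar>deg A (a i) - deg A (b i)\<bar> \<le> 9 * r" if "i \<in> I" for i
  proof -
    have i: "i < s" "\<not> deviates A (a i)" "\<not> deviates A (b i)"
        "\<epsilon> * r / 144 \<le> \<bar>deg A (a i) - deg A (b i)\<bar>"
      using that by (auto simp: I_def bad2_def)
    then have "\<bar>real (card (N (a i))) - real (card (N (b i)))\<bar> \<le> r" using ab(1) Z(3) by (auto simp: W_def)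
    with dev[OF i(2)] dev[OF i(3)] i(4) show ?thesis by linarith
  qed
  moreover have "{a i, b i} \<inter> {a j, b j} = {}" if "i \<in> I" "j \<in> I" "i \<noteq> j" for i j
    using ab(2) that by (auto simp: I_def)
  moreover have "finite I" by (simp add: I_def)
  moreover have "\<epsilon> * r / 144 > 0" using X_large by linarith
  ultimately obtain V2 where V2: "V2 \<subseteq> sum (deg A) ` Pow (a ` I \<union> b ` I)"
      "separated (real M * (\<epsilon> * r / 144)) V2" "card V2 = Suc (card I div M)"
      "\<forall>x\<in>V2. \<forall>y\<in>V2. x - y \<le> 9 * r * real (card I)"
    using exists_separated_swap_sums[of I "\<epsilon> * r / 144" M a b "deg A" "9 * r"] M_pos by blast
  have step: "18 * r \<le> real M * (\<epsilon> * r / 144)"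
  proof -
    have "2592 \<le> real M * \<epsilon>" using M eps_pos by (simp add: field_simps)
    then have "2592 * r \<le> real M * \<epsilon> * r" by (intro mult_right_mono) auto
    then show ?thesis by (simp add: mult.assoc)
  qed
  have spread2: "x - y \<le> G / 2" if "x \<in> V2" "y \<in> V2" for x y
  proof -
    have "9 * r * real (card I) \<le> 9 * r * (\<epsilon> * r / 72)"
      using I(2) s(2) by (intro mult_left_mono) auto
    also have "\<dots> = G / 2" by (simp add: Gr)
    finally show ?thesis using V2(4) that by fastforce
  qed
  have cV2: "\<epsilon> * r / (288 * real M) \<le> real (card V2)"
  proof -
    have "card I \<le> card V2 * M"
      using V2(3) M_pos by simp (metis dividend_less_div_times less_imp_le add.commute)
    then have "real (card I) \<le> real (card V2) * real M" by (metis of_nat_le_iff of_nat_mult)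
    then have "\<epsilon> * r / 288 \<le> real (card V2) * real M" using I(1) s(1) by linarith
    then show ?thesis using M_pos by (simp add: field_simps)
  qed

  \<comment> \<open>The fine sums: deleting the deviating pairs leaves at least \<open>k - f3 A\<close> distinct values.\<close>
  define P' where "P' = {\<pi> \<in> P. \<not> bad3 A \<pi>}"
  define V3 where "V3 = g A ` P'"
  have cV3: "\<epsilon> * r / 192 \<le> real (card V3)"
  proof -
    have "P = P' \<union> {\<pi> \<in> P. bad3 A \<pi>}" by (auto simp: P'_def)
    then have "card P \<le> card P' + card {\<pi> \<in> P. bad3 A \<pi>}" by (metis card_Un_le)
    moreover have "finite P'" using finP by (simp add: P'_def)
    from card_le_card_image_plus_collisions[OF this, of "g A"]
    have "card P' \<le> card V3 + card {(x, y) \<in> P' \<times> P'. x \<noteq> y \<and> g A x = g A y}" by (simp add: V3_def)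
    moreover have "card {(x, y) \<in> P' \<times> P'. x \<noteq> y \<and> g A x = g A y} \<le> card {\<pi> \<in> PP. g A (fst \<pi>) = g A (snd \<pi>)}"
    proof (rule card_mono)
      show "finite {\<pi> \<in> PP. g A (fst \<pi>) = g A (snd \<pi>)}" using finPP by simp
      show "{(x, y) \<in> P' \<times> P'. x \<noteq> y \<and> g A x = g A y} \<subseteq> {\<pi> \<in> PP. g A (fst \<pi>) = g A (snd \<pi>)}"
        unfolding PP_def P'_def by auto
    qed
    ultimately have "real k \<le> real (card V3) + f3 A" using P(6) by (simp add: f3_def)
    then show ?thesis using A(4) k(1) by linarith
  qed
  have spread3: "x - y \<le> 17 * r" if "x \<in> V3" "y \<in> V3" for x y
  proof -
    obtain \<pi> \<pi>' where \<pi>: "\<pi> \<in> P'" "x = g A \<pi>" "\<pi>' \<in> P'" "y = g A \<pi>'" using \<open>x \<in> V3\<close> \<open>y \<in> V3\<close> by (auto simp: V3_def)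
    have nd: "\<not> deviates A (fst \<pi>)" "\<not> deviates A (snd \<pi>)" "\<not> deviates A (fst \<pi>')" "\<not> deviates A (snd \<pi>')"
      using \<pi> by (auto simp: P'_def bad3_def)
    have inZ: "fst \<pi> \<in> Z" "snd \<pi> \<in> Z" "fst \<pi>' \<in> Z" "snd \<pi>' \<in> Z"
      using \<pi>(1,3) PZ[of \<pi>] PZ[of \<pi>'] P(1,2) unfolding P'_def by blast+
    have "\<bar>real (card (N (fst \<pi>))) - real (card (N (fst \<pi>')))\<bar> \<le> r"
        "\<bar>real (card (N (snd \<pi>))) - real (card (N (snd \<pi>')))\<bar> \<le> r"
      using Z(3) inZ by auto
    with dev[OF nd(1)] dev[OF nd(2)] dev[OF nd(3)] dev[OF nd(4)] show ?thesis
      unfolding \<pi> g_def by linarith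
  qed

  \<comment> \<open>Middle and fine sums are combined first; their joint spread \<open>G / 2 + 17 r\<close> is below the coarse gap \<open>G\<close>.\<close>
  define V23 where "V23 = (\<lambda>(v, w). v + w) ` (V2 \<times> V3)"
  have cV23: "card V23 = card V2 * card V3"
    unfolding V23_def using step spread3 r_ge
    by (intro card_sumset_separated[OF V2(2)]) fastforce
  have "x - y < G" if xy: "x \<in> V23" "y \<in> V23" for x y
  proof -
    obtain v w v' w' where "v \<in> V2" "w \<in> V3" "x = v + w" "v' \<in> V2" "w' \<in> V3" "y = v' + w'"
      using xy by (auto simp: V23_def)
    with spread2[of v v'] spread3[of w w'] G r_ge show ?thesis by linarith
  qed
  then have "card ((\<lambda>(v, w). v + w) ` (V1 \<times> V23)) = card V1 * card V23"
    by (intro card_sumset_separated[OF V1(2)])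
  moreover have "(\<lambda>(v, w). v + w) ` (V1 \<times> V23) \<subseteq> sum (deg A) ` Pow Y"
  proof
    fix x assume "x \<in> (\<lambda>(v, w). v + w) ` (V1 \<times> V23)"
    then obtain v1 v2 v3 where v: "v1 \<in> V1" "v2 \<in> V2" "v3 \<in> V3" "x = v1 + (v2 + v3)"
      by (auto simp: V23_def)
    obtain S1 where S1: "S1 \<subseteq> B'" "v1 = sum (deg A) S1" using v(1) V1(1) by auto
    obtain S2 where S2: "S2 \<subseteq> a ` I \<union> b ` I" "v2 = sum (deg A) S2" using v(2) V2(1) by auto
    obtain \<pi> where \<pi>: "\<pi> \<in> P" "v3 = g A \<pi>" using v(3) by (auto simp: V3_def P'_def)
    define S3 where "S3 = {fst \<pi>, snd \<pi>}"
    have pz: "fst \<pi> \<in> Z1" "snd \<pi> \<in> Z2" using PZ \<pi> by auto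
    have "fst \<pi> \<noteq> snd \<pi>" using pz P(3) by (metis disjoint_iff)
    then have v3: "v3 = sum (deg A) S3" using \<pi>(2) by (simp add: S3_def g_def)
    have S2T: "S2 \<subseteq> T" using S2(1) by (auto simp: T_def I_def)
    have "S1 \<inter> U = {}" using S1(1) by (auto simp: B'_def B_def)
    then have d: "S1 \<inter> (S2 \<union> S3) = {}" "S2 \<inter> S3 = {}"
      using S2T T(1) pz by (auto simp: U_def S3_def W_def)
    have sub: "S1 \<subseteq> Y" "S2 \<subseteq> Y" "S3 \<subseteq> Y"
      using S1(1) S2T T(1) WY pz ZY by (auto simp: B'_def B_def S3_def)
    then have "finite S1" "finite S2" "finite S3" using finite_Y finite_subset by blast+
    with d have "x = sum (deg A) (S1 \<union> (S2 \<union> S3))"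
      by (simp add: sum.union_disjoint v(4) S1(2) S2(2) v3)
    with sub show "x \<in> sum (deg A) ` Pow Y" by blast
  qed
  ultimately have "card V1 * (card V2 * card V3) \<le> card (sum (deg A) ` Pow Y)"
    using cV23 finite_Y by (metis card_mono finite_Pow_iff finite_imageI)
  then have total: "real (card V1) * (real (card V2) * real (card V3)) \<le> real (card (sum (deg A) ` Pow Y))"
    by (metis of_nat_le_iff of_nat_mult)
  have "\<epsilon>\<^sup>2 / (221184 * real M) * real (card X * card Y) =
      (real (card Y) / 4) * ((\<epsilon> * r / (288 * real M)) * (\<epsilon> * r / 192))"
  proof -
    have "real (card X * card Y) = (r * r) * real (card Y)" by simp
    then show ?thesis by (simp only: power2_eq_square) (simp add: field_simps)
  qed
  also have "\<dots> \<le> real (card V1) * (real (card V2) * real (card V3))"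
    using V1(3) cV2 cV3 eps_pos by (intro mult_mono mult_nonneg_nonneg divide_nonneg_nonneg) auto
  also have "\<dots> \<le> real (card (sum (deg A) ` Pow Y))" by (rule total)
  finally show ?thesis using A(1) unfolding M_def by blast
qed

end

section \<open>Bipartite Ramsey graphs are rich\<close>

lemma few_near_complete_of_no_biclique:
  assumes "finite X" and "finite Y"
    and no_biclique: "\<And>A B. A \<subseteq> X \<Longrightarrow> B \<subseteq> Y \<Longrightarrow> card A = a \<Longrightarrow> card B = b \<Longrightarrow> \<exists>x\<in>A. \<exists>y\<in>B. x \<notin> N y"
    and "0 < \<epsilon>" and "\<epsilon> \<le> 1 / 8" and "U \<subseteq> X"
    and large: "real a \<le> (1 - 4 * \<epsilon>) ^ b * (real (card U) / 2)"
  shows "card {y \<in> Y. real (card (U - N y)) \<le> \<epsilon> * real (card U)} \<le> 2 * b"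
proof (rule ccontr)
  let ?W = "{y \<in> Y. real (card (U - N y)) \<le> \<epsilon> * real (card U)}"
  assume "\<not> ?thesis"
  then have cW: "2 * b \<le> card ?W" by simp
  have finU: "finite U" using assms(1,6) finite_subset by blast
  have finW: "finite ?W" using assms(2) by simp
  have "\<exists>B\<subseteq>?W. card B = b \<and>
      (1 - 4 * \<epsilon>) ^ b * (real (card U) / 2) \<le> real (card {x \<in> U. \<forall>y\<in>B. x \<in> N y})"
    by (rule exists_biclique_of_near_complete[OF finU finW assms(4,5) _ cW]) simp
  then obtain B where B: "B \<subseteq> ?W" "card B = b"
      "(1 - 4 * \<epsilon>) ^ b * (real (card U) / 2) \<le> real (card {x \<in> U. \<forall>y\<in>B. x \<in> N y})"
    by blast
  then have "a \<le> card {x \<in> U. \<forall>y\<in>B. x \<in> N y}" using large by linarith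
  then obtain A where A: "A \<subseteq> {x \<in> U. \<forall>y\<in>B. x \<in> N y}" "card A = a"
    by (meson obtain_subset_with_card_n)
  then show False using no_biclique[of A B] B(1,2) assms(6) by blast
qed

lemma bipartite_ramsey_sym: "bipartite_ramsey C G X Y \<Longrightarrow> bipartite_ramsey C G Y X"
proof -
  assume R: "bipartite_ramsey C G X Y"
  then have "bipartite_graph G Y X"
    unfolding bipartite_ramsey_def bipartite_graph_def by (metis Int_commute Un_commute insert_commute)
  moreover have "\<not> (\<exists>A B. A \<subseteq> Y \<and> B \<subseteq> X \<and> card A = a \<and> card B = b \<and>
      ((\<forall>x \<in> A. \<forall>y \<in> B. {x, y} \<in> edges G) \<or> (\<forall>x \<in> A. \<forall>y \<in> B. {x, y} \<notin> edges G)))"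
    if "real a \<ge> C * ln (real (card Y))" "real b \<ge> C * ln (real (card X))" for a b :: nat
  proof
    assume "\<exists>A B. A \<subseteq> Y \<and> B \<subseteq> X \<and> card A = a \<and> card B = b \<and>
      ((\<forall>x \<in> A. \<forall>y \<in> B. {x, y} \<in> edges G) \<or> (\<forall>x \<in> A. \<forall>y \<in> B. {x, y} \<notin> edges G))"
    then obtain A B where AB: "A \<subseteq> Y" "B \<subseteq> X" "card A = a" "card B = b"
      and hom: "(\<forall>x \<in> A. \<forall>y \<in> B. {x, y} \<in> edges G) \<or> (\<forall>x \<in> A. \<forall>y \<in> B. {x, y} \<notin> edges G)"
      by blast
    have "(\<forall>x \<in> B. \<forall>y \<in> A. {x, y} \<in> edges G) \<or> (\<forall>x \<in> B. \<forall>y \<in> A. {x, y} \<notin> edges G)"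
      using hom
    proof
      assume "\<forall>x \<in> A. \<forall>y \<in> B. {x, y} \<in> edges G"
      then have "\<forall>x \<in> B. \<forall>y \<in> A. {x, y} \<in> edges G" by (metis insert_commute)
      then show ?thesis ..
    next
      assume "\<forall>x \<in> A. \<forall>y \<in> B. {x, y} \<notin> edges G"
      then have "\<forall>x \<in> B. \<forall>y \<in> A. {x, y} \<notin> edges G" by (metis insert_commute)
      then show ?thesis ..
    qed
    with R[unfolded bipartite_ramsey_def, THEN conjunct2, rule_format, OF that(2,1)] AB
    show False by blast
  qed
  ultimately show ?thesis unfolding bipartite_ramsey_def by blast
qed

definition nbhd :: "'a graph \<Rightarrow> 'a set \<Rightarrow> 'a \<Rightarrow> 'a set" where
  "nbhd G X y = {x \<in> X. {x, y} \<in> edges G}"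

lemma bipartite_graph_finite:
  assumes "bipartite_graph G X Y"
  shows "finite X" and "finite Y"
proof -
  have "finite (verts G)" "verts G = X \<union> Y"
    using assms unfolding bipartite_graph_def finite_simple_graph_def by blast+
  then show "finite X" "finite Y" by simp_all
qed

lemma edge_count_induced:
  assumes "bipartite_graph G X Y" and "A \<subseteq> X" and "B \<subseteq> Y"
  shows "card {e \<in> edges G. e \<subseteq> A \<union> B} = (\<Sum>y\<in>B. card (nbhd G X y \<inter> A))"
proof -
  have XY: "X \<inter> Y = {}" and edge: "\<forall>e \<in> edges G. \<exists>x \<in> X. \<exists>y \<in> Y. e = {x, y}"
    using assms(1) unfolding bipartite_graph_def by blast+
  note fin = bipartite_graph_finite[OF assms(1)]
  let ?S = "SIGMA y:B. nbhd G X y \<inter> A"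
  have "{e \<in> edges G. e \<subseteq> A \<union> B} = (\<lambda>(y, x). {x, y}) ` ?S"
  proof (intro equalityI subsetI)
    fix e assume "e \<in> {e \<in> edges G. e \<subseteq> A \<union> B}"
    then have e: "e \<in> edges G" "e \<subseteq> A \<union> B" by simp_all
    obtain x y where xy: "x \<in> X" "y \<in> Y" "e = {x, y}" using bspec[OF edge e(1)] by blast
    then have "x \<in> A" "y \<in> B" using e(2) assms(2,3) XY by blast+
    then have "(y, x) \<in> ?S" using xy e(1) by (simp add: nbhd_def)
    then show "e \<in> (\<lambda>(y, x). {x, y}) ` ?S" using xy(3) by (metis (no_types, lifting) case_prod_conv image_eqI)
  next
    fix e assume "e \<in> (\<lambda>(y, x). {x, y}) ` ?S"
    then obtain y x where "y \<in> B" "x \<in> nbhd G X y \<inter> A" "e = {x, y}" by blast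
    then show "e \<in> {e \<in> edges G. e \<subseteq> A \<union> B}" by (simp add: nbhd_def)
  qed
  moreover have "inj_on (\<lambda>(y, x). {x, y}) ?S"
  proof (rule inj_onI, clarify)
    fix y x y' x' assume "y \<in> B" "x \<in> nbhd G X y" "y' \<in> B" "x' \<in> nbhd G X y'" "{x, y} = {x', y'}"
    then show "y = y' \<and> x = x'" using XY assms(3) unfolding nbhd_def doubleton_eq_iff by blast
  qed
  ultimately have "card {e \<in> edges G. e \<subseteq> A \<union> B} = card ?S" by (simp add: card_image)
  also have "\<dots> = (\<Sum>y\<in>B. card (nbhd G X y \<inter> A))"
    using fin assms(2,3) finite_subset[of A X] finite_subset[of B Y] by (intro card_SigmaI) auto
  finally show ?thesis .
qed

text \<open>Once the part \<open>A\<close> in \<open>X\<close> is fixed, the number of edges is additive in the part chosen in \<open>Y\<close>.\<close>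

lemma card_subset_sums_le_Phi:
  assumes "bipartite_graph G X Y" and "A \<subseteq> X"
  shows "card (sum (\<lambda>y. real (card (nbhd G X y \<inter> A))) ` Pow Y) \<le> Phi G"
proof -
  have V: "verts G = X \<union> Y" and sg: "finite_simple_graph G"
    using assms(1) unfolding bipartite_graph_def by blast+
  have "edges G \<subseteq> Pow (verts G)" using sg by (auto simp: finite_simple_graph_def)
  then have finE: "finite (edges G)"
    using sg by (metis finite_Pow_iff finite_simple_graph_def finite_subset)
  have "induced_sizes G \<subseteq> {..card (edges G)}"
    using finE by (auto simp: induced_sizes_def edge_count_def induced_subgraph_def intro!: card_mono)
  then have fin: "finite (induced_sizes G)" using finite_subset by blast
  have "sum (\<lambda>y. real (card (nbhd G X y \<inter> A))) ` Pow Y \<subseteq> real ` induced_sizes G"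
  proof clarify
    fix B assume B: "B \<subseteq> Y"
    define H where "H = (A \<union> B, {e \<in> edges G. e \<subseteq> A \<union> B})"
    have "induced_subgraph H G" using assms(2) B V by (auto simp: H_def induced_subgraph_def)
    then have "edge_count H \<in> induced_sizes G" unfolding induced_sizes_def by blast
    moreover have "(\<Sum>y\<in>B. real (card (nbhd G X y \<inter> A))) = real (edge_count H)"
      using edge_count_induced[OF assms B] by (simp add: H_def edge_count_def)
    ultimately show "(\<Sum>y\<in>B. real (card (nbhd G X y \<inter> A))) \<in> real ` induced_sizes G"
      by (intro image_eqI)
  qed
  then have "card (sum (\<lambda>y. real (card (nbhd G X y \<inter> A))) ` Pow Y) \<le> card (real ` induced_sizes G)"
    using fin by (intro card_mono) auto
  also have "\<dots> = Phi G" unfolding Phi_def by (intro card_image) auto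
  finally show ?thesis .
qed

lemma power_one_minus_ge_exp:
  fixes t :: real
  assumes "0 \<le> t" and "t \<le> 1 / 2"
  shows "exp (- 2 * t * real b) \<le> (1 - t) ^ b"
proof -
  have "- 2 * t \<le> - t - 2 * t\<^sup>2"
    using assms mult_left_mono[of t "1/2" t] by (simp add: power2_eq_square)
  also have "\<dots> \<le> ln (1 - t)" using assms by (rule ln_one_minus_pos_lower_bound)
  finally have "exp (- 2 * t) \<le> 1 - t" using assms by (simp add: ln_ge_iff)
  then have "exp (- 2 * t) ^ b \<le> (1 - t) ^ b" by (intro power_mono) auto
  then show ?thesis unfolding exp_of_nat2_mult .
qed

text \<open>How large \<open>m\<close> has to be: first for the greedy choice to leave enough points, then for the two size conditions of
  \<open>rich_bigraph\<close> with \<open>D = 2 b + 1\<close>, using \<open>\<surd>p \<ge> m\<^bsup>\<alpha>/2\<^esup>\<close>.\<close>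

lemma eventually_ramsey_scales:
  fixes C \<alpha> \<epsilon> :: real
  assumes "C > 0" and "\<alpha> > 0" and "\<epsilon> > 0"
  shows "\<forall>\<^sub>F m :: nat in sequentially.
    C * ln (real m) + 1 \<le> exp (-1) * (\<epsilon> / 8) * real m powr (\<alpha> / 2) \<and>
    100 * (2 * (C * ln (real m) + 1) + 1) ^ 4 \<le> real m powr (\<alpha> / 2) \<and>
    144 \<le> \<epsilon> * real m powr (\<alpha> / 2) \<and> 1 \<le> m"
proof -
  define \<beta> where "\<beta> = \<alpha> / 2"
  define K where "K = exp (-1) * (\<epsilon> / 8)"
  have pos: "\<beta> > 0" "K > 0" using assms by (auto simp: \<beta>_def K_def)
  have "\<forall>\<^sub>F m :: nat in sequentially. C * ln (real m) + 1 \<le> K * real m powr \<beta>"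
    using assms pos by real_asymp
  moreover have "\<forall>\<^sub>F m :: nat in sequentially. 100 * (2 * (C * ln (real m) + 1) + 1) ^ 4 \<le> real m powr \<beta>"
    using assms pos by real_asymp
  moreover have "\<forall>\<^sub>F m :: nat in sequentially. 144 \<le> \<epsilon> * real m powr \<beta>"
    using assms pos by real_asymp
  ultimately show ?thesis
    using eventually_ge_at_top[of "1 :: nat"] unfolding \<beta>_def K_def by eventually_elim auto
qed

text \<open>The greedy choice of \<open>b \<approx> C log q\<close> vertices keeps a proportion \<open>(1 - 4 \<epsilon>)\<^sup>b\<close> of half of a set of size \<open>\<Omega>(m\<^sup>\<alpha>)\<close>.
  This proportion is at least \<open>m\<^bsup>-\<alpha>/2\<^esup> / e\<close> because \<open>16 \<epsilon> C \<le> \<alpha>\<close>. What is left is more than \<open>C log p\<close> points once \<open>m\<close> is large, so the Ramsey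
  property excludes it.\<close>

lemma Phi_ge_of_scales:
  fixes C \<alpha> \<epsilon> :: real
  assumes "C > 0" and "\<epsilon> > 0" and "\<epsilon> \<le> 1 / 8" and "16 * \<epsilon> * C \<le> \<alpha>"
    and R: "bipartite_ramsey C G X Y" and m: "card X * card Y = m"
    and X: "real m powr \<alpha> \<le> real (card X)" and le: "card X \<le> card Y"
    and scale1: "C * ln (real m) + 1 \<le> exp (-1) * (\<epsilon> / 8) * real m powr (\<alpha> / 2)"
    and scale2: "100 * (2 * (C * ln (real m) + 1) + 1) ^ 4 \<le> real m powr (\<alpha> / 2)"
    and scale3: "144 \<le> \<epsilon> * real m powr (\<alpha> / 2)" and "1 \<le> m"
  shows "\<epsilon>\<^sup>2 / (221184 * real (nat \<lceil>2592 / \<epsilon>\<rceil>)) * real m \<le> real (Phi G)"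
proof -
  define N where "N = nbhd G X"
  define a where "a = nat \<lceil>C * ln (real (card X))\<rceil>"
  define b where "b = nat \<lceil>C * ln (real (card Y))\<rceil>"
  have B: "bipartite_graph G X Y" using R by (simp add: bipartite_ramsey_def)
  note fin = bipartite_graph_finite[OF B]
  have NX: "N y \<subseteq> X" for y by (auto simp: N_def nbhd_def)
  have pos: "card X > 0" "card Y > 0" using m \<open>1 \<le> m\<close> by (auto intro: Nat.gr0I)
  then have "card X \<le> m" "card Y \<le> m" using m by auto
  then have "ln (real (card X)) \<le> ln (real m)" "ln (real (card Y)) \<le> ln (real m)" using pos by auto
  then have "C * ln (real (card X)) \<le> C * ln (real m)" "C * ln (real (card Y)) \<le> C * ln (real m)"
    using assms(1) by auto
  moreover have "C * ln (real (card X)) \<ge> 0" "C * ln (real (card Y)) \<ge> 0" using pos assms(1) by auto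
  ultimately have ab: "real a \<le> C * ln (real m) + 1" "real b \<le> C * ln (real m) + 1"
    unfolding a_def b_def by linarith+
  have ab': "C * ln (real (card X)) \<le> real a" "C * ln (real (card Y)) \<le> real b"
    unfolding a_def b_def by linarith+
  have no: "\<not> (\<exists>A B. A \<subseteq> X \<and> B \<subseteq> Y \<and> card A = a \<and> card B = b \<and>
      ((\<forall>x \<in> A. \<forall>y \<in> B. {x, y} \<in> edges G) \<or> (\<forall>x \<in> A. \<forall>y \<in> B. {x, y} \<notin> edges G)))"
    using R ab' unfolding bipartite_ramsey_def by blast
  have no1: "\<exists>x\<in>A. \<exists>y\<in>B. x \<notin> N y" if "A \<subseteq> X" "B \<subseteq> Y" "card A = a" "card B = b" for A B
  proof (rule ccontr)
    assume "\<not> ?thesis"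
    then have "\<forall>x\<in>A. \<forall>y\<in>B. {x, y} \<in> edges G" by (auto simp: N_def nbhd_def)
    with no that show False by blast
  qed
  \<comment> \<open>Exchanging edges and non-edges covers the almost empty vertices.\<close>
  have no2: "\<exists>x\<in>A. \<exists>y\<in>B. x \<notin> X - N y" if "A \<subseteq> X" "B \<subseteq> Y" "card A = a" "card B = b" for A B
  proof (rule ccontr)
    assume "\<not> ?thesis"
    then have "\<forall>x\<in>A. \<forall>y\<in>B. {x, y} \<notin> edges G" by (auto simp: N_def nbhd_def)
    with no that show False by blast
  qed
  have root: "real m powr (\<alpha> / 2) \<le> sqrt (real (card X))"
  proof -
    have "(real m powr (\<alpha> / 2))\<^sup>2 = real m powr \<alpha>"
      by (simp add: power2_eq_square flip: powr_add)
    then show ?thesis using X by (intro real_le_rsqrt) simp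
  qed
  have large: "real a \<le> (1 - 4 * \<epsilon>) ^ b * (real (card U) / 2)"
    if "\<epsilon> / 4 * real (card X) \<le> real (card U)" for U
  proof -
    have "8 * \<epsilon> * real b \<le> 8 * \<epsilon> * (C * ln (real m) + 1)"
      using ab(2) assms(2) by (intro mult_left_mono) auto
    also have "\<dots> = (8 * \<epsilon> * C) * ln (real m) + 8 * \<epsilon>" by (simp add: algebra_simps)
    also have "\<dots> \<le> (\<alpha> / 2) * ln (real m) + 1"
      using assms(3,4) \<open>1 \<le> m\<close> by (intro add_mono mult_right_mono) auto
    finally have "- 1 - (\<alpha> / 2) * ln (real m) \<le> - 2 * (4 * \<epsilon>) * real b" by simp
    then have "exp (- 1 - (\<alpha> / 2) * ln (real m)) \<le> exp (- 2 * (4 * \<epsilon>) * real b)" by simp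
    also have "\<dots> \<le> (1 - 4 * \<epsilon>) ^ b" using assms(2,3) by (intro power_one_minus_ge_exp) auto
    also have "exp (- 1 - (\<alpha> / 2) * ln (real m)) = exp (-1) * real m powr (- (\<alpha> / 2))"
      using \<open>1 \<le> m\<close> by (simp add: powr_def flip: exp_add)
    finally have 1: "exp (-1) * real m powr (- (\<alpha> / 2)) \<le> (1 - 4 * \<epsilon>) ^ b" .
    have "\<epsilon> / 4 * real m powr \<alpha> \<le> \<epsilon> / 4 * real (card X)"
      using X assms(2) by (intro mult_left_mono) auto
    then have 2: "\<epsilon> / 8 * real m powr \<alpha> \<le> real (card U) / 2" using that by linarith
    have "real m powr (\<alpha> / 2) = real m powr (- (\<alpha> / 2)) * real m powr \<alpha>" by (simp flip: powr_add)
    then have "exp (-1) * (\<epsilon> / 8) * real m powr (\<alpha> / 2) =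
        (exp (-1) * real m powr (- (\<alpha> / 2))) * (\<epsilon> / 8 * real m powr \<alpha>)" by simp
    also have "\<dots> \<le> (1 - 4 * \<epsilon>) ^ b * (real (card U) / 2)"
      using 1 2 assms(2,3) by (intro mult_mono) auto
    finally show ?thesis using ab(1) scale1 by linarith
  qed
  have dense: "card {y \<in> Y. real (card (U - N y)) \<le> \<epsilon> * real (card U)} \<le> 2 * b"
    if "U \<subseteq> X" "\<epsilon> / 4 * real (card X) \<le> real (card U)" for U
    using fin no1 assms(2,3) that(1) large[OF that(2)] by (rule few_near_complete_of_no_biclique)
  have sparse: "card {y \<in> Y. real (card (N y \<inter> U)) \<le> \<epsilon> * real (card U)} \<le> 2 * b"
    if "U \<subseteq> X" "\<epsilon> / 4 * real (card X) \<le> real (card U)" for U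
  proof -
    have "card {y \<in> Y. real (card (U - (X - N y))) \<le> \<epsilon> * real (card U)} \<le> 2 * b"
      using fin no2 assms(2,3) that(1) large[OF that(2)] by (rule few_near_complete_of_no_biclique)
    moreover have "U - (X - N y) = N y \<inter> U" for y using that(1) by blast
    ultimately show ?thesis by simp
  qed
  \<comment> \<open>\<open>2 b + 1\<close> instead of \<open>2 b\<close>, since the locale asks for a positive number.\<close>
  interpret rich_bigraph X Y N \<epsilon> "2 * b + 1"
  proof
    show "card {y \<in> Y. real (card (U - N y)) \<le> \<epsilon> * real (card U)} \<le> 2 * b + 1"
      if "U \<subseteq> X" "\<epsilon> / 4 * real (card X) \<le> real (card U)" for U
      using dense[OF that] by linarith
    show "card {y \<in> Y. real (card (N y \<inter> U)) \<le> \<epsilon> * real (card U)} \<le> 2 * b + 1"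
      if "U \<subseteq> X" "\<epsilon> / 4 * real (card X) \<le> real (card U)" for U
      using sparse[OF that] by linarith
    have "100 * real (2 * b + 1) ^ 4 \<le> 100 * (2 * (C * ln (real m) + 1) + 1) ^ 4"
      using ab(2) by (intro mult_left_mono power_mono) auto
    then show "100 * real (2 * b + 1) ^ 4 \<le> sqrt (real (card X))" using scale2 root by linarith
    have "\<epsilon> * real m powr (\<alpha> / 2) \<le> \<epsilon> * sqrt (real (card X))"
      using root assms(2) by (intro mult_left_mono) auto
    then show "144 \<le> \<epsilon> * sqrt (real (card X))" using scale3 by linarith
  qed (use fin NX assms le in auto)
  obtain A where A: "A \<subseteq> X" "\<epsilon>\<^sup>2 / (221184 * real (nat \<lceil>2592 / \<epsilon>\<rceil>)) * real (card X * card Y)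
      \<le> real (card (sum (deg A) ` Pow Y))"
    using many_subset_sums by blast
  have deg_A: "deg A = (\<lambda>y. real (card (nbhd G X y \<inter> A)))"
    by (rule ext) (simp only: deg_def, simp only: N_def)
  have "card (sum (deg A) ` Pow Y) \<le> Phi G"
    unfolding deg_A by (rule card_subset_sums_le_Phi[OF B A(1)])
  then have "real (card (sum (deg A) ` Pow Y)) \<le> real (Phi G)" by (rule of_nat_mono)
  with A(2)[unfolded m] show ?thesis by (rule order_trans)
qed

theorem theorem1p5:
  fixes C \<alpha> :: real
  assumes "C > 0" and "\<alpha> > 0"
  shows "\<exists>c :: real. \<exists>m\<^sub>0 :: nat. c > 0 \<and>
    (\<forall>m \<ge> m\<^sub>0. \<forall>(G :: 'a graph) X Y.
       bipartite_ramsey C G X Y \<longrightarrow>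
       card X * card Y = m \<longrightarrow>
       real (card X) \<ge> real m powr \<alpha> \<longrightarrow>
       real (card Y) \<ge> real m powr \<alpha> \<longrightarrow>
       real (Phi G) \<ge> c * real m)"
proof -
  define \<epsilon> where "\<epsilon> = min (1 / 8) (\<alpha> / (16 * C))"
  define c where "c = \<epsilon>\<^sup>2 / (221184 * real (nat \<lceil>2592 / \<epsilon>\<rceil>))"
  have eps: "\<epsilon> > 0" "\<epsilon> \<le> 1 / 8" using assms by (auto simp: \<epsilon>_def)
  have "\<epsilon> \<le> \<alpha> / (16 * C)" by (simp add: \<epsilon>_def)
  then have eps': "16 * \<epsilon> * C \<le> \<alpha>" using assms(1) by (simp add: field_simps)
  have "0 < 2592 / \<epsilon>" using eps by simp
  then have "c > 0" using eps unfolding c_def by (intro divide_pos_pos mult_pos_pos) auto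
  obtain m\<^sub>0 where m\<^sub>0: "\<And>m. m \<ge> m\<^sub>0 \<Longrightarrow>
      C * ln (real m) + 1 \<le> exp (-1) * (\<epsilon> / 8) * real m powr (\<alpha> / 2) \<and>
      100 * (2 * (C * ln (real m) + 1) + 1) ^ 4 \<le> real m powr (\<alpha> / 2) \<and>
      144 \<le> \<epsilon> * real m powr (\<alpha> / 2) \<and> 1 \<le> m"
    using eventually_ramsey_scales[OF assms eps(1)] unfolding eventually_sequentially by blast
  have "c * real m \<le> real (Phi G)"
    if "m \<ge> m\<^sub>0" "bipartite_ramsey C G X Y" "card X * card Y = m"
      "real m powr \<alpha> \<le> real (card X)" "real m powr \<alpha> \<le> real (card Y)"
    for m and G :: "'a graph" and X Y
  proof (cases "card X \<le> card Y")
    case True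
    show ?thesis unfolding c_def
      using Phi_ge_of_scales[OF assms(1) eps eps' that(2,3,4) True] m\<^sub>0[OF that(1)] by blast
  next
    case False
    have "card Y * card X = m" "card Y \<le> card X" using that(3) False by (auto simp: mult.commute)
    from Phi_ge_of_scales[OF assms(1) eps eps' bipartite_ramsey_sym[OF that(2)] this(1) that(5) this(2)]
    show ?thesis unfolding c_def using m\<^sub>0[OF that(1)] by blast
  qed
  with \<open>c > 0\<close> show ?thesis by blast
qed

end
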